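(* Any 4-dimensional exterior static spherically symmetric Bach-flat space-time $(V,\bar g)$ is almost conformally Einstein. More specifically, any such static spherically symmetric Bach-flat space-time is almost conformal to a subset of a Schwarzschild–de Sitter (or Schwarzschild–anti-de Sitter) space-time, with metric $$-\left(1-\frac mr-\frac\Lambda3r^2\right)dt^2+\frac{dr^2}{1-\frac mr-\frac\Lambda3r^2}+r^2g_{\mathbb{S}^2}\qquad (m,\Lambda\in\mathbb{R}),$$ or to the metric $$-\cos^2x\,dT^2+dx^2+g_{\mathbb{S}^2}.$$
   Context: A static spherically symmetric space-time here is $V=I\times\mathbb{S}^2\times\mathbb{R}$, with $I\subset(0,\infty)$ an interval (coordinate $r$), $t$ the coordinate on the factor $\mathbb{R}$, the orthogonal group acting by isometries on the $\mathbb{S}^2$ factor, and Lorentzian metric of the form $\bar g=-U(r)^2dt^2+W(r)^2dr^2+r^2g_{\mathbb{S}^2}$ with $U,W>0$ (the coefficient of $g_{\mathbb{S}^2}$ is assumed to be the square of a monotonically increasing function of the radial variable, which is then taken as the coordinate $r$). Here $g_{\mathbb{S}^2}$ is the round metric on the unit sphere, and $(T,x)$ in the last metric are coordinates on the two remaining dimensions. Bach-flat: the Bach tensor $B_{\mu\nu}=\left(\nabla^\rho\nabla^\lambda+\frac12\mathrm{Ric}^{\rho\lambda}\right)W_{\rho\mu\lambda\nu}$ of $\bar g$ vanishes, where $W_{\rho\mu\lambda\nu}$ is the Weyl tensor (equivalently, $\bar g$ satisfies the Euler–Lagrange equations of $\int(\alpha R^2+\beta|\mathrm{Ric}|^2)\,dV$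 with $3\alpha+\beta=0$, $\alpha\ne0$). $(V,\bar g)$ is almost conformally Einstein if there exists at most one radius $r_s$ such that both for $r<r_s$ and for $r>r_s$ the metric is conformally Einstein. A Lorentzian metric $\bar g^*$ is almost conformal to $\bar g$ if there is some conformal transformation between them which is defined almost everywhere (that is, there may be topological spheres separating connected regions which are globally conformal to one of the model spaces). *)

theory Defs
  imports "HOL-Analysis.Analysis"
begin

section \<open>Smooth maps\<close>

text \<open>The following two notions are meant for open sets \<open>S\<close>.\<close>

primrec Ck_on :: "nat \<Rightarrow> 'a::euclidean_space set \<Rightarrow> ('a \<Rightarrow> 'b::real_normed_vector) \<Rightarrow> bool" where
  "Ck_on 0 S f \<longleftrightarrow> continuous_on S f"
| "Ck_on (Suc k) S f \<longleftrightarrow>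
     (\<forall>x\<in>S. f differentiable (at x)) \<and>
     (\<forall>v. Ck_on k S (\<lambda>x. frechet_derivative f (at x) v))"

definition smooth_on :: "'a::euclidean_space set \<Rightarrow> ('a \<Rightarrow> 'b::real_normed_vector) \<Rightarrow> bool" where
  "smooth_on S f \<longleftrightarrow> (\<forall>k. Ck_on k S f)"

section \<open>Curvature of a metric on an open subset of four-space\<close>

text \<open>
  All manifolds that occur are open subsets of \<open>real^4\<close> (see the next section), so that tensor
  fields are given by their components in one global chart.  Conventions:
  \<open>R\<^sup>a\<^sub>b\<^sub>c\<^sub>d = \<partial>\<^sub>c \<Gamma>\<^sup>a\<^sub>d\<^sub>b - \<partial>\<^sub>d \<Gamma>\<^sup>a\<^sub>c\<^sub>b + \<Gamma>\<^sup>a\<^sub>c\<^sub>e \<Gamma>\<^sup>e\<^sub>d\<^sub>b - \<Gamma>\<^sup>a\<^sub>d\<^sub>e \<Gamma>\<^sup>e\<^sub>c\<^sub>b\<close> and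
  \<open>Ric\<^sub>b\<^sub>d = R\<^sup>a\<^sub>b\<^sub>a\<^sub>d\<close>, so round spheres have positive Ricci curvature.
\<close>

type_synonym point = "real^4"
type_synonym metric = "real^4 \<Rightarrow> real^4^4"

definition pd :: "4 \<Rightarrow> (point \<Rightarrow> real) \<Rightarrow> point \<Rightarrow> real" where
  "pd k F p = frechet_derivative F (at p) (axis k 1)"

definition ginv :: "metric \<Rightarrow> 4 \<Rightarrow> 4 \<Rightarrow> point \<Rightarrow> real" where
  "ginv g a b p = matrix_inv (g p) $ a $ b"

definition christoffel :: "metric \<Rightarrow> 4 \<Rightarrow> 4 \<Rightarrow> 4 \<Rightarrow> point \<Rightarrow> real" where
  "christoffel g k i j p =
     (\<Sum>l\<in>UNIV. ginv g k l p *
        (pd i (\<lambda>q. g q $ j $ l) p + pd j (\<lambda>q. g q $ i $ l) p - pd l (\<lambda>q. g q $ i $ j) p)) / 2"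

definition riemann_up :: "metric \<Rightarrow> 4 \<Rightarrow> 4 \<Rightarrow> 4 \<Rightarrow> 4 \<Rightarrow> point \<Rightarrow> real" where
  "riemann_up g a b c d p =
     pd c (christoffel g a d b) p - pd d (christoffel g a c b) p
     + (\<Sum>e\<in>UNIV. christoffel g a c e p * christoffel g e d b p
                - christoffel g a d e p * christoffel g e c b p)"

definition riemann :: "metric \<Rightarrow> 4 \<Rightarrow> 4 \<Rightarrow> 4 \<Rightarrow> 4 \<Rightarrow> point \<Rightarrow> real" where
  "riemann g a b c d p = (\<Sum>e\<in>UNIV. g p $ a $ e * riemann_up g e b c d p)"

definition ricci :: "metric \<Rightarrow> 4 \<Rightarrow> 4 \<Rightarrow> point \<Rightarrow> real" where
  "ricci g b d p = (\<Sum>a\<in>UNIV. riemann_up g a b a d p)"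

definition scalar_curv :: "metric \<Rightarrow> point \<Rightarrow> real" where
  "scalar_curv g p = (\<Sum>a\<in>UNIV. \<Sum>b\<in>UNIV. ginv g a b p * ricci g a b p)"

definition weyl :: "metric \<Rightarrow> 4 \<Rightarrow> 4 \<Rightarrow> 4 \<Rightarrow> 4 \<Rightarrow> point \<Rightarrow> real" where
  "weyl g a b c d p =
     riemann g a b c d p
     - (g p $ a $ c * ricci g b d p - g p $ a $ d * ricci g b c p
        - g p $ b $ c * ricci g a d p + g p $ b $ d * ricci g a c p) / 2
     + scalar_curv g p / 6 * (g p $ a $ c * g p $ b $ d - g p $ a $ d * g p $ b $ c)"

text \<open>Covariant derivatives of covariant tensors of rank four and five; the new index comes first.\<close>

definition nabla4 ::
  "metric \<Rightarrow> (4 \<Rightarrow> 4 \<Rightarrow> 4 \<Rightarrow> 4 \<Rightarrow> point \<Rightarrow> real) \<Rightarrow>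
   4 \<Rightarrow> 4 \<Rightarrow> 4 \<Rightarrow> 4 \<Rightarrow> 4 \<Rightarrow> point \<Rightarrow> real" where
  "nabla4 g T e a b c d p =
     pd e (T a b c d) p
     - (\<Sum>l\<in>UNIV. christoffel g l e a p * T l b c d p + christoffel g l e b p * T a l c d p
                + christoffel g l e c p * T a b l d p + christoffel g l e d p * T a b c l p)"

definition nabla5 ::
  "metric \<Rightarrow> (4 \<Rightarrow> 4 \<Rightarrow> 4 \<Rightarrow> 4 \<Rightarrow> 4 \<Rightarrow> point \<Rightarrow> real) \<Rightarrow>
   4 \<Rightarrow> 4 \<Rightarrow> 4 \<Rightarrow> 4 \<Rightarrow> 4 \<Rightarrow> 4 \<Rightarrow> point \<Rightarrow> real" where
  "nabla5 g T f e a b c d p =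
     pd f (T e a b c d) p
     - (\<Sum>l\<in>UNIV. christoffel g l f e p * T l a b c d p + christoffel g l f a p * T e l b c d p
                + christoffel g l f b p * T e a l c d p + christoffel g l f c p * T e a b l d p
                + christoffel g l f d p * T e a b c l p)"

definition bach :: "metric \<Rightarrow> 4 \<Rightarrow> 4 \<Rightarrow> point \<Rightarrow> real" where
  "bach g m n p =
     (\<Sum>r\<in>UNIV. \<Sum>l\<in>UNIV. \<Sum>a\<in>UNIV. \<Sum>b\<in>UNIV. ginv g r a p * ginv g l b p *
        (nabla5 g (nabla4 g (weyl g)) a b r m l n p + ricci g a b p * weyl g r m l n p / 2))"

definition bach_flat_on :: "point set \<Rightarrow> metric \<Rightarrow> bool" where
  "bach_flat_on S g \<longleftrightarrow> (\<forall>p\<in>S. \<forall>m n. bach g m n p = 0)"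

definition einstein_on :: "point set \<Rightarrow> metric \<Rightarrow> bool" where
  "einstein_on S g \<longleftrightarrow> (\<exists>k. \<forall>p\<in>S. \<forall>a b. ricci g a b p = k * g p $ a $ b)"

definition conformally_einstein_on :: "point set \<Rightarrow> metric \<Rightarrow> bool" where
  "conformally_einstein_on S g \<longleftrightarrow>
     (\<exists>\<Omega>. smooth_on S \<Omega> \<and> (\<forall>p\<in>S. \<Omega> p > 0) \<and> einstein_on S (\<lambda>p. (\<Omega> p)\<^sup>2 *\<^sub>R g p))"

text \<open>\<open>\<phi>\<close> is a conformal diffeomorphism from \<open>(S, g)\<close> onto an open subset of \<open>(T, h)\<close>.\<close>

definition conformal_map ::
  "point set \<Rightarrow> metric \<Rightarrow> point set \<Rightarrow> metric \<Rightarrow> (point \<Rightarrow> point) \<Rightarrow> bool" where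
  "conformal_map S g T h \<phi> \<longleftrightarrow>
     \<phi> ` S \<subseteq> T \<and> open (\<phi> ` S) \<and> inj_on \<phi> S \<and>
     smooth_on S \<phi> \<and> smooth_on (\<phi> ` S) (inv_into S \<phi>) \<and>
     (\<exists>\<Omega>. smooth_on S \<Omega> \<and> (\<forall>p\<in>S. \<Omega> p > 0) \<and>
        (\<forall>p\<in>S. \<forall>u v.
           frechet_derivative \<phi> (at p) u \<bullet> (h (\<phi> p) *v frechet_derivative \<phi> (at p) v)
           = (\<Omega> p)\<^sup>2 * (u \<bullet> (g p *v v))))"

section \<open>Spherically symmetric metrics\<close>

text \<open>
  For an open \<open>J \<subseteq> \<real>\<close> the manifold \<open>J \<times> S\<^sup>2 \<times> \<real>\<close> is identified with an open subset of \<open>real^4\<close>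
  through the diffeomorphism \<open>(r, \<omega>, t) \<mapsto> (t, exp r \<cdot> \<omega>)\<close>, where \<open>S\<^sup>2\<close> is the unit sphere in
  three-space.  Index \<open>1\<close> is the \<open>t\<close>-direction, the other three indices carry \<open>y = exp r \<cdot> \<omega>\<close>, so
  that \<open>r = ln |y|\<close> and \<open>\<omega> = y / |y|\<close>.  The exponential lets \<open>r\<close> range over arbitrary real
  intervals; every component below depends on \<open>r\<close> itself.
\<close>

definition ycoord :: "4 \<Rightarrow> point \<Rightarrow> real" where
  "ycoord i p = (if i = 1 then 0 else p $ i)"

definition ynorm2 :: "point \<Rightarrow> real" where
  "ynorm2 p = (\<Sum>i\<in>UNIV. (ycoord i p)\<^sup>2)"

definition rad :: "point \<Rightarrow> real" where
  "rad p = ln (sqrt (ynorm2 p))"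

definition shell :: "real set \<Rightarrow> point set" where
  "shell J = {p. ynorm2 p \<noteq> 0 \<and> rad p \<in> J}"

text \<open>
  Components of the one-forms \<open>dt\<close> and \<open>dr = y\<cdot>dy / |y|\<^sup>2\<close>, and of the pull-back
  \<open>|d(y/|y|)|\<^sup>2 = (|dy|\<^sup>2 - (y\<cdot>dy)\<^sup>2 / |y|\<^sup>2) / |y|\<^sup>2\<close> of the round metric of the unit sphere.
\<close>

definition dt_form :: "4 \<Rightarrow> point \<Rightarrow> real" where
  "dt_form i p = (if i = 1 then 1 else 0)"

definition dr_form :: "4 \<Rightarrow> point \<Rightarrow> real" where
  "dr_form i p = ycoord i p / ynorm2 p"

definition sphere_form :: "4 \<Rightarrow> 4 \<Rightarrow> point \<Rightarrow> real" where
  "sphere_form i j p =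
     ((if i = j \<and> i \<noteq> 1 then 1 else 0) - ycoord i p * ycoord j p / ynorm2 p) / ynorm2 p"

text \<open>\<open>-A(r) dt\<^sup>2 + B(r) dr\<^sup>2 + C(r) g\<^sub>S\<close> with \<open>g\<^sub>S\<close> the round metric of the unit two-sphere.\<close>

definition sym_metric :: "(real \<Rightarrow> real) \<Rightarrow> (real \<Rightarrow> real) \<Rightarrow> (real \<Rightarrow> real) \<Rightarrow> metric" where
  "sym_metric A B C = (\<lambda>p. \<chi> i j.
     - A (rad p) * dt_form i p * dt_form j p
     + B (rad p) * dr_form i p * dr_form j p
     + C (rad p) * sphere_form i j p)"

definition static_metric :: "(real \<Rightarrow> real) \<Rightarrow> (real \<Rightarrow> real) \<Rightarrow> metric" where
  "static_metric U W = sym_metric (\<lambda>r. (U r)\<^sup>2) (\<lambda>r. (W r)\<^sup>2) (\<lambda>r. r\<^sup>2)"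

text \<open>
  For the Schwarzschild--(anti-)de Sitter metric every nonzero \<open>r\<close> at which the components are
  regular is admitted.  The part with \<open>r < 0\<close> and mass parameter \<open>m\<close> is isometric, by
  \<open>r \<mapsto> -r\<close>, to the part with \<open>r > 0\<close> and mass parameter \<open>-m\<close>.  Both signs are needed for a
  single almost everywhere defined map: across an exceptional sphere \<open>r\<close> passes through infinity
  and comes back with the opposite sign.
\<close>

definition sds_lapse :: "real \<Rightarrow> real \<Rightarrow> real \<Rightarrow> real" where
  "sds_lapse m \<Lambda> r = 1 - m / r - \<Lambda> / 3 * r\<^sup>2"

definition sds_metric :: "real \<Rightarrow> real \<Rightarrow> metric" where
  "sds_metric m \<Lambda> = sym_metric (sds_lapse m \<Lambda>) (\<lambda>r. 1 / sds_lapse m \<Lambda> r) (\<lambda>r. r\<^sup>2)"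

definition sds_space :: "real \<Rightarrow> real \<Rightarrow> point set" where
  "sds_space m \<Lambda> = shell {r. r \<noteq> 0 \<and> sds_lapse m \<Lambda> r \<noteq> 0}"

text \<open>Here the radial variable is \<open>x\<close>, restricted to an interval on which \<open>cos x\<close> has no zero.\<close>

definition cos_metric :: metric where
  "cos_metric = sym_metric (\<lambda>x. (cos x)\<^sup>2) (\<lambda>x. 1) (\<lambda>x. 1)"

definition cos_space :: "point set" where
  "cos_space = shell {- pi / 2 <..< pi / 2}"

section \<open>Almost conformal notions\<close>

definition almost_conformally_einstein :: "real set \<Rightarrow> metric \<Rightarrow> bool" where
  "almost_conformally_einstein I g \<longleftrightarrow>
     conformally_einstein_on (shell I) g \<or>
     (\<exists>rs\<in>I. conformally_einstein_on (shell (I \<inter> {..<rs})) g \<and>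
              conformally_einstein_on (shell (I \<inter> {rs<..})) g)"

text \<open>The exceptional set consists of finitely many spheres \<open>r = const\<close>.\<close>

definition almost_conformal :: "real set \<Rightarrow> metric \<Rightarrow> point set \<Rightarrow> metric \<Rightarrow> bool" where
  "almost_conformal I g T h \<longleftrightarrow>
     (\<exists>E \<phi>. finite E \<and> conformal_map (shell (I - E)) g T h \<phi>)"

end

theory Submission
  imports Defs
begin

text \<open>
  The idea is to pass to the conformal metric \<open>r\<^sup>-\<^sup>2 g = -F dt\<^sup>2 + dx\<^sup>2/F + g\<^sub>S\<close> with
  \<open>F = (U/r)\<^sup>2\<close> and \<open>dx = (U W/r\<^sup>2) dr\<close>, the product of a Lorentzian surface with the unit sphere.
  Only the function \<open>F\<close> of \<open>x\<close> is left.  The Bach tensor is conformally covariant, and for such a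
  product it vanishes exactly when \<open>F'''' = 0\<close> and \<open>2 F' F''' - F''\<^sup>2 + 4 = 0\<close>.  So \<open>F\<close> is a
  polynomial \<open>b\<^sub>0 + b\<^sub>1 x + c x\<^sup>2 + d x\<^sup>3\<close> with \<open>c\<^sup>2 - 3 b\<^sub>1 d = 1\<close>, which says that \<open>F'' = \<plusminus>2\<close> at every
  zero of \<open>F'\<close>.  There are two cases.

  If \<open>F'\<close> has a zero with \<open>F'' = 2\<close>, let \<open>y\<close> be \<open>x\<close> measured from this zero.  Then
  \<open>F = d y\<^sup>3 + y\<^sup>2 + e\<close>, and \<open>y\<^sup>-\<^sup>2 r\<^sup>-\<^sup>2 g\<close>, written in the variable \<open>1/y\<close>, is the Schwarzschild--de Sitter
  metric with \<open>m = -d\<close> and \<open>\<Lambda> = -3 e\<close>.  Because \<open>dy/dr > 0\<close>, there is at most one radius with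
  \<open>y = 0\<close>.  It is the exceptional sphere: there \<open>1/y\<close> passes through infinity and changes sign.

  Otherwise \<open>F\<close> is a concave quadratic \<open>k\<^sup>2 - y\<^sup>2\<close>, with \<open>k > 0\<close> because \<open>F > 0\<close>.  The substitutions
  \<open>y = k sin x\<close> and \<open>T = k t\<close> turn \<open>r\<^sup>-\<^sup>2 g\<close> into \<open>-cos\<^sup>2 x dT\<^sup>2 + dx\<^sup>2 + g\<^sub>S\<close>, which is itself Einstein.

  In the formal proof the two equations for \<open>F\<close> are read off from the Bach tensor of \<open>g\<close> directly.
  Let \<open>e0 = U dt\<close>, \<open>e1 = W dr\<close> and let \<open>gsph\<close> be the spherical part of the metric.  The covariant
  derivatives of these three tensors are again polynomials in them, so \<open>\<nabla>\<close> acts as a derivation on the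
  tensors that they generate.  The Weyl tensor is a function of \<open>r\<close> times a fixed such polynomial
  (\<open>weyl_shape\<close>), which makes \<open>\<nabla>\<nabla>W\<close> a mechanical computation (\<open>nabla_nabla_weyl\<close>).  By symmetry
  it suffices to look at one point of each orbit, and two components of the Bach tensor are
  enough (\<open>bach_axis\<close>, \<open>bach_flat_ode\<close>).  The variable \<open>x\<close> is never introduced: differentiation
  by \<open>x\<close> is \<open>(r\<^sup>2/(U W)) d/dr\<close>, and \<open>y\<close> is an explicit expression in \<open>F''\<close> or \<open>F'\<close>
  (\<open>profile_ode_solution\<close>).  The same curvature formulas, applied to the rescaled metric, give the
  Einstein condition, and radial maps provide the conformal diffeomorphisms.
\<close>

section \<open>Smooth functions\<close>

text \<open>
  Closure properties are proved for each order \<open>k\<close> separately, by induction on \<open>k\<close>: the derivative of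
  a combination is a combination of the same kind, one order lower.
\<close>

lemma Ck_on_SucD: "Ck_on (Suc k) S f \<Longrightarrow> Ck_on k S f"
proof (induction k arbitrary: f)
  case 0
  then show ?case
    by (auto intro!: continuous_at_imp_continuous_on differentiable_imp_continuous_within)
next
  case (Suc k)
  then show ?case by (metis Ck_on.simps(2))
qed

lemma Ck_on_subset: "Ck_on k S f \<Longrightarrow> T \<subseteq> S \<Longrightarrow> Ck_on k T f"
  by (induction k arbitrary: f) (auto intro: continuous_on_subset)

lemma Ck_on_cong:
  assumes "open S" "Ck_on k S f" "\<And>x. x \<in> S \<Longrightarrow> f x = g x"
  shows "Ck_on k S g"
  using assms(2,3)
proof (induction k arbitrary: f g)
  case 0
  then show ?case by (auto cong: continuous_on_cong)
next
  case (Suc k)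
  have D: "(g has_derivative frechet_derivative f (at x)) (at x)" if "x \<in> S" for x
    using Suc.prems that by (auto intro: has_derivative_transform_within_open[OF _ \<open>open S\<close>] simp: frechet_derivative_works)
  then have "frechet_derivative g (at x) = frechet_derivative f (at x)" if "x \<in> S" for x
    using that frechet_derivative_at by metis
  with D show ?case
    using Suc.IH[of "\<lambda>x. frechet_derivative f (at x) v" "\<lambda>x. frechet_derivative g (at x) v" for v] Suc.prems
    by (auto simp: differentiable_def)
qed

lemma Ck_on_SucI:
  assumes "open S" "\<And>x. x \<in> S \<Longrightarrow> (f has_derivative f' x) (at x)" "\<And>v. Ck_on k S (\<lambda>x. f' x v)"
  shows "Ck_on (Suc k) S f"
proof -
  have "frechet_derivative f (at x) = f' x" if "x \<in> S" for x
    using assms(2)[OF that] frechet_derivative_at by metis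
  then show ?thesis
    using assms by (auto simp: differentiable_def intro!: Ck_on_cong[OF assms(1) assms(3)])
qed

lemma Ck_on_SucE:
  assumes "Ck_on (Suc k) S f" "x \<in> S"
  shows "(f has_derivative frechet_derivative f (at x)) (at x)"
  using assms by (auto simp: frechet_derivative_works)

lemma Ck_on_const: "Ck_on k S (\<lambda>x. c)"
  by (induction k arbitrary: c) auto

lemma Ck_on_add:
  assumes "open S" "Ck_on k S f" "Ck_on k S g"
  shows "Ck_on k S (\<lambda>x. f x + g x)"
  using assms(2,3)
proof (induction k arbitrary: f g)
  case (Suc k)
  show ?case
    by (rule Ck_on_SucI[OF \<open>open S\<close> has_derivative_add[OF Suc.prems[THEN Ck_on_SucE]]], assumption+)
      (use Suc in auto)
qed (auto intro: continuous_intros)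

lemma Ck_on_bounded_linear:
  assumes "open S" "bounded_linear L" "Ck_on k S f"
  shows "Ck_on k S (\<lambda>x. L (f x))"
  using assms(3)
proof (induction k arbitrary: f)
  case 0 then show ?case using assms(2) by (auto intro: bounded_linear.continuous_on)
next
  case (Suc k)
  show ?case
    by (rule Ck_on_SucI[OF \<open>open S\<close> bounded_linear.has_derivative[OF assms(2) Suc.prems[THEN Ck_on_SucE]]], assumption+)
      (use Suc in auto)
qed

lemma Ck_on_bounded_bilinear:
  assumes "open S" "bounded_bilinear B" "Ck_on k S f" "Ck_on k S g"
  shows "Ck_on k S (\<lambda>x. B (f x) (g x))"
  using assms(3,4)
proof (induction k arbitrary: f g)
  case 0 then show ?case using assms(2) by (auto intro: bounded_bilinear.continuous_on)
next
  case (Suc k)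
  show ?case
    by (rule Ck_on_SucI[OF \<open>open S\<close> bounded_bilinear.FDERIV[OF assms(2) Suc.prems[THEN Ck_on_SucE]]], assumption+)
      (intro Ck_on_add[OF \<open>open S\<close>] Suc.IH Ck_on_SucD[OF Suc.prems(1)] Ck_on_SucD[OF Suc.prems(2)]; use Suc.prems in auto)
qed

lemma Ck_on_ident: "Ck_on k S (\<lambda>x. x)"
  by (cases k) (auto simp: Ck_on_const frechet_derivative_ident[unfolded id_def])

text \<open>
  The outer function has one real variable.  Then the chain rule contains the single function
  \<open>f' \<circ> g\<close>, so that the induction hypothesis applies to it without expanding a direction in a basis.
\<close>

lemma Ck_on_compose_real:
  fixes f :: "real \<Rightarrow> real"
  assumes "open S" "open T" "Ck_on k T f" "Ck_on k S g" "g ` S \<subseteq> T"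
  shows "Ck_on k S (\<lambda>x. f (g x))"
  using assms(3-5)
proof (induction k arbitrary: f g)
  case 0 then show ?case by (auto intro: continuous_on_compose2)
next
  case (Suc k)
  have "((\<lambda>x. f (g x)) has_derivative (\<lambda>v. frechet_derivative f (at (g x)) 1 * frechet_derivative g (at x) v)) (at x)"
    if "x \<in> S" for x
  proof -
    have gx: "g x \<in> T" using that Suc.prems by auto
    have "f differentiable at (g x)" using Suc.prems(1) gx by simp
    then obtain D where D: "(f has_derivative (\<lambda>s. D * s)) (at (g x))"
      unfolding real_differentiable_def has_field_derivative_def by blast
    have "frechet_derivative f (at (g x)) 1 = D"
      using frechet_derivative_at[OF D] by (metis mult.right_neutral)
    with D have "(f has_derivative (\<lambda>s. frechet_derivative f (at (g x)) 1 * s)) (at (g x))"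
      by simp
    from diff_chain_at[OF Ck_on_SucE[OF Suc.prems(2) that] this] show ?thesis
      by (simp add: o_def)
  qed
  note D = this
  show ?case
  proof (rule Ck_on_SucI[OF \<open>open S\<close> D])
    fix v
    show "Ck_on k S (\<lambda>x. frechet_derivative f (at (g x)) 1 * frechet_derivative g (at x) v)"
    proof (rule Ck_on_bounded_bilinear[OF \<open>open S\<close> bounded_bilinear_mult])
      show "Ck_on k S (\<lambda>x. frechet_derivative f (at (g x)) 1)"
        by (rule Suc.IH[of "\<lambda>s. frechet_derivative f (at s) 1"]) (use Suc.prems Ck_on_SucD[OF Suc.prems(2)] in auto)
      show "Ck_on k S (\<lambda>x. frechet_derivative g (at x) v)" using Suc.prems by simp
    qed
  qed auto
qed

lemma Ck_on_real_deriv: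
  fixes f :: "real \<Rightarrow> real"
  assumes "open S" "\<And>x. x \<in> S \<Longrightarrow> (f has_real_derivative f' x) (at x)" "Ck_on k S f'"
  shows "Ck_on (Suc k) S f"
  by (rule Ck_on_SucI[OF assms(1) assms(2)[unfolded has_field_derivative_def]], assumption)
    (intro Ck_on_bounded_bilinear[OF assms(1) bounded_bilinear_mult] assms(3) Ck_on_const)

lemma smooth_on_subset: "smooth_on S f \<Longrightarrow> T \<subseteq> S \<Longrightarrow> smooth_on T f"
  by (auto simp: smooth_on_def intro: Ck_on_subset)

lemma smooth_on_cong: "open S \<Longrightarrow> smooth_on S f \<Longrightarrow> (\<And>x. x \<in> S \<Longrightarrow> f x = g x) \<Longrightarrow> smooth_on S g"
  by (auto simp: smooth_on_def intro: Ck_on_cong)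

lemma smooth_on_const: "smooth_on S (\<lambda>x. c)"
  and smooth_on_ident: "smooth_on S (\<lambda>x. x)"
  by (auto simp: smooth_on_def Ck_on_const Ck_on_ident)

lemma smooth_on_add: "open S \<Longrightarrow> smooth_on S f \<Longrightarrow> smooth_on S g \<Longrightarrow> smooth_on S (\<lambda>x. f x + g x)"
  by (auto simp: smooth_on_def intro: Ck_on_add)

lemma smooth_on_linear: "open S \<Longrightarrow> bounded_linear L \<Longrightarrow> smooth_on S f \<Longrightarrow> smooth_on S (\<lambda>x. L (f x))"
  by (auto simp: smooth_on_def intro: Ck_on_bounded_linear)

lemma smooth_on_minus: "open S \<Longrightarrow> smooth_on S f \<Longrightarrow> smooth_on S (\<lambda>x. - f x)"
  by (rule smooth_on_linear[of _ uminus]) (auto intro: bounded_linear_minus bounded_linear_ident)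

lemma smooth_on_diff: "open S \<Longrightarrow> smooth_on S f \<Longrightarrow> smooth_on S g \<Longrightarrow> smooth_on S (\<lambda>x. f x - g x)"
  using smooth_on_add[of S f "\<lambda>x. - g x"] smooth_on_minus[of S g] by simp

lemma smooth_on_mult:
  fixes f g :: "_ \<Rightarrow> real"
  shows "open S \<Longrightarrow> smooth_on S f \<Longrightarrow> smooth_on S g \<Longrightarrow> smooth_on S (\<lambda>x. f x * g x)"
  by (auto simp: smooth_on_def intro: Ck_on_bounded_bilinear bounded_bilinear_mult)

lemma smooth_on_scaleR:
  "open S \<Longrightarrow> smooth_on S f \<Longrightarrow> smooth_on S g \<Longrightarrow> smooth_on S (\<lambda>x. f x *\<^sub>R g x)"
  by (auto simp: smooth_on_def intro: Ck_on_bounded_bilinear bounded_bilinear_scaleR)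

lemma smooth_on_power:
  fixes f :: "_ \<Rightarrow> real"
  shows "open S \<Longrightarrow> smooth_on S f \<Longrightarrow> smooth_on S (\<lambda>x. f x ^ n)"
  by (induction n) (simp_all add: smooth_on_const smooth_on_mult)

lemma smooth_on_compose_real:
  fixes f :: "real \<Rightarrow> real"
  assumes "smooth_on T f" "open S" "open T" "smooth_on S g" "\<And>x. x \<in> S \<Longrightarrow> g x \<in> T"
  shows "smooth_on S (\<lambda>x. f (g x))"
  unfolding smooth_on_def
  by (rule allI, rule Ck_on_compose_real[OF assms(2,3)]) (use assms in \<open>auto simp: smooth_on_def\<close>)

lemma smooth_on_real_deriv:
  fixes f :: "real \<Rightarrow> real"
  assumes "open S" "\<And>x. x \<in> S \<Longrightarrow> (f has_real_derivative f' x) (at x)" "smooth_on S f'"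
  shows "smooth_on S f"
  unfolding smooth_on_def
proof
  fix k
  have "Ck_on (Suc k) S f" by (rule Ck_on_real_deriv[OF assms(1,2)]) (use assms(3) in \<open>auto simp: smooth_on_def\<close>)
  then show "Ck_on k S f" by (rule Ck_on_SucD)
qed

lemma smooth_on_deriv:
  fixes f :: "real \<Rightarrow> real"
  assumes "open S" "smooth_on S f"
  shows "\<And>x. x \<in> S \<Longrightarrow> (f has_real_derivative deriv f x) (at x)" "smooth_on S (deriv f)"
proof -
  show 1: "(f has_real_derivative deriv f x) (at x)" if "x \<in> S" for x
  proof -
    have "Ck_on (Suc 0) S f" using assms by (simp add: smooth_on_def)
    then have "f differentiable at x" using that by simp
    then show ?thesis
      by (simp add: DERIV_deriv_iff_real_differentiable)
  qed
  show "smooth_on S (deriv f)"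
    unfolding smooth_on_def
  proof
    fix k
    have "Ck_on (Suc k) S f" using assms by (simp add: smooth_on_def)
    then have "Ck_on k S (\<lambda>x. frechet_derivative f (at x) 1)" by simp
    then show "Ck_on k S (deriv f)"
    proof (rule Ck_on_cong[OF assms(1)])
      fix x assume "x \<in> S"
      then show "frechet_derivative f (at x) 1 = deriv f x"
        using frechet_derivative_at[OF 1[unfolded has_field_derivative_def], of x] by (metis mult.right_neutral)
    qed
  qed
qed

lemma smooth_on_exp: "smooth_on UNIV (exp :: real \<Rightarrow> real)"
  unfolding smooth_on_def
proof
  fix k show "Ck_on k UNIV (exp :: real \<Rightarrow> real)"
    by (induction k) (auto intro!: continuous_intros Ck_on_real_deriv DERIV_exp simp del: Ck_on.simps(2))
qed

lemma smooth_on_inverse_real: "smooth_on (- {0}) (inverse :: real \<Rightarrow> real)"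
  unfolding smooth_on_def
proof
  have o: "open (- {0::real})" by auto
  fix k show "Ck_on k (- {0}) (inverse :: real \<Rightarrow> real)"
  proof (induction k)
    case (Suc k)
    show ?case
    proof (rule Ck_on_real_deriv[OF o])
      show "(inverse has_real_derivative - 1 * (inverse x * inverse x)) (at x)" if "x \<in> - {0}" for x :: real
        using DERIV_inverse[of x] that by (simp add: numeral_2_eq_2)
      show "Ck_on k (- {0}) (\<lambda>x::real. - 1 * (inverse x * inverse x))"
        by (intro Ck_on_bounded_bilinear[OF o bounded_bilinear_mult] Ck_on_const Suc)
    qed
  qed (auto intro!: continuous_intros)
qed

lemma smooth_on_divide:
  fixes f g :: "_ \<Rightarrow> real"
  assumes "open S" "smooth_on S f" "smooth_on S g" "\<And>x. x \<in> S \<Longrightarrow> g x \<noteq> 0"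
  shows "smooth_on S (\<lambda>x. f x / g x)"
  unfolding divide_inverse
  by (intro smooth_on_mult smooth_on_compose_real[OF smooth_on_inverse_real] assms) (use assms in auto)

lemma smooth_on_ln: "smooth_on {0<..} (ln :: real \<Rightarrow> real)"
  by (rule smooth_on_real_deriv[where f' = inverse])
    (auto intro: DERIV_ln smooth_on_subset[OF smooth_on_inverse_real])

lemma smooth_on_sqrt: "smooth_on {0<..} sqrt"
proof (rule smooth_on_cong)
  show "smooth_on {0::real<..} (\<lambda>x. exp (ln x / 2))"
    by (rule smooth_on_compose_real[OF smooth_on_exp]) (auto intro!: smooth_on_divide smooth_on_ln smooth_on_const)
  show "exp (ln x / 2) = sqrt x" if "x \<in> {0<..}" for x :: real
    using that by (simp add: ln_sqrt[symmetric])
qed auto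

lemma smooth_on_arcsin: "smooth_on {-1<..<1} arcsin"
proof (rule smooth_on_real_deriv)
  show "(arcsin has_real_derivative 1 / sqrt (1 - x ^ 2)) (at x)" if "x \<in> {-1<..<1}" for x
    using DERIV_arcsin[of x] that by (simp add: divide_inverse)
  have "0 < 1 - x\<^sup>2" if "x \<in> {-1<..<1}" for x :: real
    using that by (simp add: abs_square_less_1 abs_less_iff)
  then show "smooth_on {-1<..<1} (\<lambda>x::real. 1 / sqrt (1 - x ^ 2))"
    by (intro smooth_on_divide smooth_on_const smooth_on_compose_real[OF smooth_on_sqrt] smooth_on_diff smooth_on_power
        smooth_on_ident) (auto simp: less_imp_neq[symmetric])
qed auto

text \<open>
  The derivative of the inverse is \<open>1/R'\<close> composed with the inverse, so regularity improves by one
  order at a time, starting from continuity.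
\<close>

lemma smooth_on_inverse_function:
  fixes R :: "real \<Rightarrow> real"
  assumes "open J" "smooth_on J R" "inj_on R J" "\<And>r. r \<in> J \<Longrightarrow> deriv R r \<noteq> 0"
  shows "open (R ` J)" "smooth_on (R ` J) (inv_into J R)"
proof -
  have c: "continuous_on J R" using assms(2) unfolding smooth_on_def by (metis Ck_on.simps(1))
  show o: "open (R ` J)" by (rule invariance_of_domain[OF c assms(1,3)])
  let ?G = "inv_into J R"
  have D: "(?G has_real_derivative 1 / deriv R (?G s)) (at s)" if s: "s \<in> R ` J" for s
  proof -
    obtain r where r: "r \<in> J" "s = R r" using s by auto
    have "(?G has_derivative (*) (1 / deriv R r)) (at (R r))"
    proof (rule has_derivative_inverse_strong[OF assms(1) r(1) c])
      show "(R has_derivative (*) (deriv R r)) (at r)"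
        using smooth_on_deriv(1)[OF assms(1,2) r(1)] by (simp add: has_field_derivative_def)
      show "(*) (deriv R r) \<circ> (*) (1 / deriv R r) = id" using assms(4)[OF r(1)] by (auto simp: fun_eq_iff)
    qed (use assms(3) in auto)
    then have "(?G has_real_derivative 1 / deriv R r) (at (R r))" by (simp add: has_field_derivative_def)
    then show ?thesis using r assms(3) by simp
  qed
  show "smooth_on (R ` J) ?G"
    unfolding smooth_on_def
  proof
    fix k show "Ck_on k (R ` J) ?G"
    proof (induction k)
      case 0
      show ?case using DERIV_isCont[OF D] by (simp add: continuous_at_imp_continuous_on)
    next
      case (Suc k)
      have 1: "smooth_on J (\<lambda>r. 1 / deriv R r)"
        by (intro smooth_on_divide smooth_on_const smooth_on_deriv assms)
      have "Ck_on k (R ` J) (\<lambda>s. (\<lambda>r. 1 / deriv R r) (?G s))"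
        by (rule Ck_on_compose_real[OF o assms(1)]) (use 1 Suc in \<open>auto simp: smooth_on_def inv_into_into assms(3)\<close>)
      then show ?case by (intro Ck_on_real_deriv[OF o D])
    qed
  qed
qed

section \<open>Calculus in the global chart\<close>

text \<open>
  The partial derivatives of \<open>F\<close> at \<open>p\<close>, together with total differentiability; the latter makes
  the product and chain rules available.
\<close>

definition has_grad :: "(point \<Rightarrow> real) \<Rightarrow> (4 \<Rightarrow> real) \<Rightarrow> point \<Rightarrow> bool" where
  "has_grad F D p \<longleftrightarrow> (F has_derivative (\<lambda>h. \<Sum>k\<in>UNIV. D k * h $ k)) (at p)"

lemma pd_eq:
  assumes "has_grad F D p" shows "pd k F p = D k"
proof -
  have "frechet_derivative F (at p) = (\<lambda>h. \<Sum>k\<in>UNIV. D k * h $ k)"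
    using assms frechet_derivative_at unfolding has_grad_def by metis
  then show ?thesis by (simp add: pd_def axis_def if_distrib cong: if_cong)
qed

lemma has_grad_eq_rhs: "has_grad F D p \<Longrightarrow> (\<And>k. D k = E k) \<Longrightarrow> has_grad F E p"
  by (simp add: has_grad_def)

lemma has_grad_const: "has_grad (\<lambda>p. c) (\<lambda>k. 0) p"
  by (simp add: has_grad_def)

lemma has_grad_nth: "has_grad (\<lambda>p. p $ i) (\<lambda>k. if k = i then 1 else 0) p"
proof -
  have "((\<lambda>p. p $ i) has_derivative (\<lambda>h. h $ i)) (at p)"
    by (intro bounded_linear.has_derivative[OF bounded_linear_vec_nth] derivative_intros)
  then show ?thesis by (simp add: has_grad_def if_distrib[of "\<lambda>x. x * _"] cong: if_cong)
qed

lemma has_grad_add: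
  assumes "has_grad F D p" "has_grad G E p"
  shows "has_grad (\<lambda>q. F q + G q) (\<lambda>k. D k + E k) p"
  using has_derivative_add[OF assms[unfolded has_grad_def]]
  by (simp add: has_grad_def distrib_right sum.distrib)

lemma has_grad_diff:
  assumes "has_grad F D p" "has_grad G E p"
  shows "has_grad (\<lambda>q. F q - G q) (\<lambda>k. D k - E k) p"
  using has_derivative_diff[OF assms[unfolded has_grad_def]]
  by (simp add: has_grad_def left_diff_distrib sum_subtractf)

lemma has_grad_mult:
  assumes "has_grad F D p" "has_grad G E p"
  shows "has_grad (\<lambda>q. F q * G q) (\<lambda>k. D k * G p + F p * E k) p"
proof -
  have "((\<lambda>q. F q * G q) has_derivative
     (\<lambda>h. F p * (\<Sum>k\<in>UNIV. E k * h $ k) + (\<Sum>k\<in>UNIV. D k * h $ k) * G p)) (at p)"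
    using has_derivative_mult[OF assms[unfolded has_grad_def]] .
  moreover have "(\<lambda>h. F p * (\<Sum>k\<in>UNIV. E k * h $ k) + (\<Sum>k\<in>UNIV. D k * h $ k) * G p)
     = (\<lambda>h. \<Sum>k\<in>UNIV. (D k * G p + F p * E k) * h $ k)"
    by (rule ext) (simp add: sum_distrib_left sum_distrib_right sum.distrib[symmetric] algebra_simps)
  ultimately show ?thesis by (simp add: has_grad_def)
qed

lemma has_grad_chain:
  assumes "has_grad F D p" "(f has_real_derivative f') (at (F p))"
  shows "has_grad (\<lambda>q. f (F q)) (\<lambda>k. f' * D k) p"
proof -
  have "((\<lambda>q. f (F q)) has_derivative (\<lambda>h. f' * (\<Sum>k\<in>UNIV. D k * h $ k))) (at p)"
    using diff_chain_at[OF assms(1)[unfolded has_grad_def] assms(2)[unfolded has_field_derivative_def]]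
    by (simp add: o_def)
  then show ?thesis by (simp add: has_grad_def sum_distrib_left mult.assoc)
qed

lemma has_grad_divide:
  assumes "has_grad F D p" "has_grad G E p" "G p \<noteq> 0"
  shows "has_grad (\<lambda>q. F q / G q) (\<lambda>k. (D k * G p - F p * E k) / (G p)\<^sup>2) p"
proof -
  have "((\<lambda>x. inverse x) has_real_derivative - (inverse (G p))\<^sup>2) (at (G p))"
    using DERIV_inverse[OF assms(3)] by (simp add: numeral_2_eq_2)
  from has_grad_mult[OF assms(1) has_grad_chain[OF assms(2) this]]
  show ?thesis
    unfolding divide_inverse
    by (rule has_grad_eq_rhs) (use assms(3) in \<open>simp add: field_simps power2_eq_square\<close>)
qed

lemma has_grad_sum:
  assumes "\<And>i. i \<in> A \<Longrightarrow> has_grad (F i) (D i) p"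
  shows "has_grad (\<lambda>q. \<Sum>i\<in>A. F i q) (\<lambda>k. \<Sum>i\<in>A. D i k) p"
  using assms
proof (induction A rule: infinite_finite_induct)
  case (insert x A)
  then show ?case by (simp add: has_grad_add)
qed (simp_all add: has_grad_const)

lemma has_grad_cong_open:
  assumes "has_grad F D p" "open S" "p \<in> S" "\<And>q. q \<in> S \<Longrightarrow> F q = G q"
  shows "has_grad G D p"
  using has_derivative_transform_within_open[OF assms(1)[unfolded has_grad_def] assms(2,3)] assms(4)
  by (auto simp: has_grad_def)

lemma four_cases: obtains "(i::4) = 1" | "i = 2" | "i = 3" | "i = 4"
  using exhaust_4 by auto

lemma ynorm2_4: "ynorm2 p = (p$2)\<^sup>2 + (p$3)\<^sup>2 + (p$4)\<^sup>2"
  by (simp add: ynorm2_def ycoord_def sum_4)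

lemma has_grad_ycoord: "has_grad (ycoord i) (\<lambda>k. if k = i \<and> i \<noteq> 1 then 1 else 0) p"
proof (cases "i = 1")
  case True
  then show ?thesis by (simp add: ycoord_def[abs_def] has_grad_const)
next
  case False
  then have "ycoord i = (\<lambda>p. p $ i)" by (auto simp: ycoord_def)
  then show ?thesis using has_grad_nth[of i] False by simp
qed

lemma has_grad_ynorm2: "has_grad ynorm2 (\<lambda>k. 2 * ycoord k p) p"
proof -
  have "has_grad (\<lambda>p. \<Sum>i\<in>UNIV. (ycoord i p) * (ycoord i p))
     (\<lambda>k. \<Sum>i\<in>UNIV. (if k = i \<and> i \<noteq> 1 then 1 else 0) * ycoord i p + ycoord i p * (if k = i \<and> i \<noteq> 1 then 1 else 0)) p"
    by (intro has_grad_sum has_grad_mult has_grad_ycoord)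
  moreover have "(\<lambda>p. \<Sum>i\<in>UNIV. (ycoord i p) * (ycoord i p)) = ynorm2"
    by (auto simp: ynorm2_def power2_eq_square)
  moreover have "(\<Sum>i\<in>UNIV. (if k = i \<and> i \<noteq> 1 then 1 else 0) * ycoord i p + ycoord i p * (if k = i \<and> i \<noteq> 1 then 1 else 0))
     = 2 * ycoord k p" for k
    by (cases k rule: four_cases) (simp_all add: sum_4 ycoord_def)
  ultimately show ?thesis by simp
qed

lemma ynorm2_nonneg: "ynorm2 p \<ge> 0"
  by (simp add: ynorm2_def sum_nonneg)

lemma has_grad_rad:
  assumes "ynorm2 p \<noteq> 0" shows "has_grad rad (\<lambda>k. dr_form k p) p"
proof -
  have pos: "ynorm2 p > 0" using assms ynorm2_nonneg[of p] by linarith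
  have "((\<lambda>x. ln (sqrt x)) has_real_derivative (1 / (2 * ynorm2 p))) (at (ynorm2 p))"
    using pos
    by (auto intro!: derivative_eq_intros simp: field_simps real_sqrt_mult[symmetric])
  from has_grad_chain[OF has_grad_ynorm2 this]
  show ?thesis
    unfolding rad_def[abs_def] by (rule has_grad_eq_rhs) (simp add: dr_form_def)
qed

lemma has_grad_radial:
  assumes "ynorm2 p \<noteq> 0" "(f has_real_derivative f') (at (rad p))"
  shows "has_grad (\<lambda>q. f (rad q)) (\<lambda>k. f' * dr_form k p) p"
  using has_grad_chain[OF has_grad_rad[OF assms(1)] assms(2)] .

lemma has_grad_dt: "has_grad (dt_form i) (\<lambda>k. 0) p"
  using has_grad_const[of "if i = 1 then 1 else 0"] by (simp add: dt_form_def[abs_def])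

lemma sphere_form_sym: "sphere_form i j p = sphere_form j i p"
  by (auto simp: sphere_form_def)

text \<open>
  The coordinate forms are closed under partial differentiation: gradients of \<open>dt_form\<close>, \<open>dr_form\<close>,
  \<open>sphere_form\<close> and \<open>ycoord\<close> are polynomials in these tensors and in \<open>sphere_proj\<close>.  Hence components
  of symmetric tensors can be differentiated without ever choosing indices.
\<close>

lemma has_grad_dr:
  assumes "ynorm2 p \<noteq> 0"
  shows "has_grad (dr_form i) (\<lambda>k. sphere_form k i p - dr_form k p * dr_form i p) p"
proof -
  from has_grad_divide[OF has_grad_ycoord[of i] has_grad_ynorm2 assms]
  show ?thesis unfolding dr_form_def[abs_def]
    by (rule has_grad_eq_rhs) (use assms in \<open>auto simp add: sphere_form_def field_simps power2_eq_square\<close>)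
qed

lemma has_grad_sphere:
  assumes "ynorm2 p \<noteq> 0"
  shows "has_grad (sphere_form i j)
    (\<lambda>k. - 2 * dr_form k p * sphere_form i j p - sphere_form k i p * dr_form j p - sphere_form k j p * dr_form i p) p"
proof -
  let ?c = "if i = j \<and> i \<noteq> 1 then 1 else (0::real)"
  have "sphere_form i j = (\<lambda>p. ?c / ynorm2 p - dr_form i p * dr_form j p)"
    by (rule ext) (auto simp: sphere_form_def dr_form_def power2_eq_square diff_divide_distrib)
  moreover have "has_grad (\<lambda>p. ?c / ynorm2 p - dr_form i p * dr_form j p)
     (\<lambda>k. (0 * ynorm2 p - ?c * (2 * ycoord k p)) / (ynorm2 p)\<^sup>2 -
       ((sphere_form k i p - dr_form k p * dr_form i p) * dr_form j p + dr_form i p * (sphere_form k j p - dr_form k p * dr_form j p))) p"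
    using assms
    by (intro has_grad_diff has_grad_divide has_grad_const has_grad_ynorm2 has_grad_mult has_grad_dr)
  ultimately show ?thesis
    using assms
    by (auto elim!: has_grad_eq_rhs simp: sphere_form_def dr_form_def field_simps power2_eq_square)
qed

text \<open>
  The projection onto the tangent space of the orbit sphere, with first index up.  The vectors dual
  to \<open>dt_form\<close> and \<open>dr_form\<close> are \<open>\<partial>\<^sub>t\<close>, whose components are again those of \<open>dt_form\<close>, and the radial
  vector \<open>ycoord\<close>.
\<close>

definition sphere_proj :: "4 \<Rightarrow> 4 \<Rightarrow> point \<Rightarrow> real" where
  "sphere_proj k i p = (if k = i \<and> i \<noteq> 1 then 1 else 0) - ycoord k p * dr_form i p"

lemma has_grad_sphere_proj:
  assumes "ynorm2 p \<noteq> 0"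
  shows "has_grad (sphere_proj a i) (\<lambda>k. - sphere_proj a k p * dr_form i p - ycoord a p * sphere_form k i p) p"
proof -
  have "has_grad (\<lambda>p. (if a = i \<and> i \<noteq> 1 then 1 else 0) - ycoord a p * dr_form i p)
    (\<lambda>k. 0 - ((if k = a \<and> a \<noteq> 1 then 1 else 0) * dr_form i p + ycoord a p * (sphere_form k i p - dr_form k p * dr_form i p))) p"
    using assms by (intro has_grad_diff has_grad_const has_grad_mult has_grad_ycoord has_grad_dr)
  then show ?thesis
    unfolding sphere_proj_def[abs_def]
    by (rule has_grad_eq_rhs) (auto simp: algebra_simps ycoord_def)
qed

lemma has_grad_ycoord':
  "has_grad (ycoord a) (\<lambda>k. sphere_proj a k p + ycoord a p * dr_form k p) p"
  by (rule has_grad_eq_rhs[OF has_grad_ycoord]) (auto simp: sphere_proj_def)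

text \<open>
  The multiplication table of the forms \<open>dt_form\<close>, \<open>dr_form\<close>, \<open>sphere_form\<close> with the vectors \<open>dt_form\<close>,
  \<open>ycoord\<close>, \<open>sphere_proj\<close>.  Every index contraction in the curvature computation reduces to it.
\<close>

lemma contractions:
  assumes n: "ynorm2 p \<noteq> 0"
  shows "(\<Sum>k\<in>UNIV. dt_form k p * dt_form k p) = 1"
    "(\<Sum>k\<in>UNIV. dt_form k p * ycoord k p) = 0"
    "(\<Sum>k\<in>UNIV. dt_form k p * sphere_proj k i p) = 0"
    "(\<Sum>k\<in>UNIV. dr_form k p * dt_form k p) = 0"
    "(\<Sum>k\<in>UNIV. dr_form k p * ycoord k p) = 1"
    "(\<Sum>k\<in>UNIV. dr_form k p * sphere_proj k i p) = 0"
    "(\<Sum>k\<in>UNIV. sphere_form j k p * dt_form k p) = 0"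
    "(\<Sum>k\<in>UNIV. sphere_form j k p * ycoord k p) = 0"
    "(\<Sum>k\<in>UNIV. sphere_form j k p * sphere_proj k i p) = sphere_form j i p"
    "(\<Sum>k\<in>UNIV. sphere_proj j k p * dt_form k p) = 0"
    "(\<Sum>k\<in>UNIV. sphere_proj j k p * ycoord k p) = 0"
    "(\<Sum>k\<in>UNIV. sphere_proj j k p * sphere_proj k i p) = sphere_proj j i p"
    "(\<Sum>k\<in>UNIV. sphere_proj k k p) = 2"
proof -
  note d = dt_form_def dr_form_def sphere_form_def sphere_proj_def
  have y: "(p $ 2)\<^sup>2 + (p $ 3)\<^sup>2 + (p $ 4)\<^sup>2 \<noteq> 0" using n by (simp add: ynorm2_4)
  define N where "N = ynorm2 p"
  have N: "N \<noteq> 0" "p$2 * p$2 = N - p$3*p$3 - p$4*p$4" using n by (auto simp: N_def ynorm2_4 power2_eq_square)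
  show "(\<Sum>k\<in>UNIV. dt_form k p * dt_form k p) = 1"
    "(\<Sum>k\<in>UNIV. dt_form k p * ycoord k p) = 0"
    "(\<Sum>k\<in>UNIV. dt_form k p * sphere_proj k i p) = 0"
    "(\<Sum>k\<in>UNIV. dr_form k p * dt_form k p) = 0"
    "(\<Sum>k\<in>UNIV. sphere_form j k p * dt_form k p) = 0"
    "(\<Sum>k\<in>UNIV. sphere_proj j k p * dt_form k p) = 0"
    by (simp_all add: sum_4 d ycoord_def)
  show ry: "(\<Sum>k\<in>UNIV. dr_form k p * ycoord k p) = 1"
    using n y by (simp add: sum_4 d ycoord_def ynorm2_4 add_divide_distrib[symmetric] power2_eq_square[symmetric])
  have A: "sphere_form j k p = sphere_proj j k p / N" for j k
    by (auto simp: d N_def ycoord_def)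
  show rP: "(\<Sum>k\<in>UNIV. dr_form k p * sphere_proj k i p) = 0" for i
    unfolding d ycoord_def N_def[symmetric] using N
    by (cases i rule: four_cases) (auto simp: sum_4 field_simps)
  show Py: "(\<Sum>k\<in>UNIV. sphere_proj j k p * ycoord k p) = 0" for j
    unfolding d ycoord_def N_def[symmetric] using N
    by (cases j rule: four_cases) (auto simp: sum_4 field_simps)
  show PP: "(\<Sum>k\<in>UNIV. sphere_proj j k p * sphere_proj k i p) = sphere_proj j i p" for j i
  proof -
    have "(\<Sum>k\<in>UNIV. sphere_proj j k p * sphere_proj k i p)
       = (\<Sum>k\<in>UNIV. (if j = k \<and> k \<noteq> 1 then 1 else 0) * sphere_proj k i p)
         - ycoord j p * (\<Sum>k\<in>UNIV. dr_form k p * sphere_proj k i p)"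
      by (simp add: sphere_proj_def[of j] sum_distrib_left sum_subtractf[symmetric] algebra_simps)
    also have "\<dots> = sphere_proj j i p"
      unfolding rP by (cases j rule: four_cases; simp add: sum_4 sphere_proj_def ycoord_def)
    finally show ?thesis .
  qed
  show "(\<Sum>k\<in>UNIV. sphere_form j k p * ycoord k p) = 0"
    "(\<Sum>k\<in>UNIV. sphere_form j k p * sphere_proj k i p) = sphere_form j i p"
    using Py[of j] PP[of j i] by (simp_all add: A sum_divide_distrib[symmetric])
  show "(\<Sum>k\<in>UNIV. sphere_proj k k p) = 2"
    using ry by (simp add: sum_4 sphere_proj_def ycoord_def algebra_simps)
qed

section \<open>Connection and curvature of a spherically symmetric metric\<close>

lemma open_shell: "open J \<Longrightarrow> open (shell J)"
proof -
  assume J: "open J"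
  have 1: "continuous_on UNIV ynorm2"
    using has_grad_ynorm2 unfolding has_grad_def
    by (intro continuous_at_imp_continuous_on ballI has_derivative_continuous)
  have o: "open {p. ynorm2 p \<noteq> 0}"
    using open_Collect_neq[OF 1 continuous_on_const] by simp
  have 2: "continuous_on {p. ynorm2 p \<noteq> 0} rad"
    using has_grad_rad unfolding has_grad_def
    by (intro continuous_at_imp_continuous_on ballI has_derivative_continuous) blast
  have "shell J = {p. ynorm2 p \<noteq> 0} \<inter> rad -` J" by (auto simp: shell_def)
  then show ?thesis using continuous_open_preimage[OF 2 o J] by simp
qed

text \<open>
  The metric is \<open>-U\<^sup>2 dt\<^sup>2 + W\<^sup>2 dr\<^sup>2 + Q\<^sup>2 g\<^sub>S\<close>.  With the proper radial derivative \<open>D = W\<^sup>-\<^sup>1 d/dr\<close>, the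
  functions \<open>u\<close>, \<open>v\<close> are the logarithmic derivatives \<open>D U / U\<close>, \<open>D Q / Q\<close>, and \<open>u1 = D u\<close>, \<open>v1 = D v\<close>;
  in these terms \<open>W\<close> drops out of the curvature.  The functions \<open>U\<close>, \<open>W\<close>, \<open>Q\<close> may be negative, which
  allows rescalings by factors without a definite sign.
\<close>

locale warped =
  fixes J :: "real set" and U W Q W1 W2 u v u1 v1 :: "real \<Rightarrow> real"
  assumes J_open: "open J"
    and nz: "r \<in> J \<Longrightarrow> U r \<noteq> 0" "r \<in> J \<Longrightarrow> W r \<noteq> 0" "r \<in> J \<Longrightarrow> Q r \<noteq> 0"
    and dU: "r \<in> J \<Longrightarrow> (U has_real_derivative u r * U r * W r) (at r)"
    and dW: "r \<in> J \<Longrightarrow> (W has_real_derivative W1 r) (at r)"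
    and dW1: "r \<in> J \<Longrightarrow> (W1 has_real_derivative W2 r) (at r)"
    and dQ: "r \<in> J \<Longrightarrow> (Q has_real_derivative v r * Q r * W r) (at r)"
    and du: "r \<in> J \<Longrightarrow> (u has_real_derivative u1 r * W r) (at r)"
    and dv: "r \<in> J \<Longrightarrow> (v has_real_derivative v1 r * W r) (at r)"
begin

definition g :: metric where
  "g = sym_metric (\<lambda>r. (U r)\<^sup>2) (\<lambda>r. (W r)\<^sup>2) (\<lambda>r. (Q r)\<^sup>2)"

lemma g_nth: "g p $ i $ j = - (U (rad p))\<^sup>2 * dt_form i p * dt_form j p
     + (W (rad p))\<^sup>2 * dr_form i p * dr_form j p + (Q (rad p))\<^sup>2 * sphere_form i j p"
  by (simp add: g_def sym_metric_def)

text \<open>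
  The Christoffel symbols in closed form.  The terms without \<open>U\<close>, \<open>W\<close>, \<open>Q\<close> come from the Cartesian
  coordinates, in which \<open>dr_form\<close> and \<open>sphere_form\<close> are not constant.
\<close>

definition conn :: "4 \<Rightarrow> 4 \<Rightarrow> 4 \<Rightarrow> point \<Rightarrow> real" where
  "conn k i j p = (let r = rad p in
     dt_form k p * ((u r * W r) * (dt_form i p * dr_form j p + dr_form i p * dt_form j p))
   + ycoord k p * (((U r)\<^sup>2 * u r / W r) * (dt_form i p * dt_form j p)
        + (W1 r / W r - 1) * (dr_form i p * dr_form j p) + (1 - (Q r)\<^sup>2 * v r / W r) * sphere_form i j p)
   + (v r * W r - 1) * (sphere_proj k i p * dr_form j p + sphere_proj k j p * dr_form i p))"

lemma conn_contract:
  "(\<Sum>l\<in>UNIV. X l * conn l i j p) =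
     (\<Sum>l\<in>UNIV. X l * dt_form l p) * ((u (rad p) * W (rad p)) * (dt_form i p * dr_form j p + dr_form i p * dt_form j p))
   + (\<Sum>l\<in>UNIV. X l * ycoord l p) * (((U (rad p))\<^sup>2 * u (rad p) / W (rad p)) * (dt_form i p * dt_form j p)
        + (W1 (rad p) / W (rad p) - 1) * (dr_form i p * dr_form j p) + (1 - (Q (rad p))\<^sup>2 * v (rad p) / W (rad p)) * sphere_form i j p)
   + (v (rad p) * W (rad p) - 1) * ((\<Sum>l\<in>UNIV. X l * sphere_proj l i p) * dr_form j p + (\<Sum>l\<in>UNIV. X l * sphere_proj l j p) * dr_form i p)"
  unfolding conn_def Let_def
  by (simp add: distrib_left sum.distrib sum_distrib_left sum_distrib_right sum_divide_distrib mult_ac)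

lemma g_has_grad:
  assumes "p \<in> shell J"
  shows "has_grad (\<lambda>q. g q $ i $ j) (\<lambda>k. let r = rad p in
     - 2 * (u r * W r * (U r)\<^sup>2) * dr_form k p * dt_form i p * dt_form j p
     + 2 * (W r * W1 r) * dr_form k p * dr_form i p * dr_form j p
     + (W r)\<^sup>2 * ((sphere_form k i p - dr_form k p * dr_form i p) * dr_form j p + dr_form i p * (sphere_form k j p - dr_form k p * dr_form j p))
     + 2 * (v r * W r * (Q r)\<^sup>2) * dr_form k p * sphere_form i j p
     + (Q r)\<^sup>2 * (- 2 * dr_form k p * sphere_form i j p - sphere_form k i p * dr_form j p - sphere_form k j p * dr_form i p)) p"
proof -
  have n: "ynorm2 p \<noteq> 0" and r: "rad p \<in> J" using assms by (auto simp: shell_def)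
  let ?r = "rad p"
  have a: "((\<lambda>r. - (U r)\<^sup>2) has_real_derivative - (2 * (u ?r * W ?r * (U ?r)\<^sup>2))) (at ?r)"
    by (rule derivative_eq_intros dU r refl)+ (simp add: power2_eq_square)
  have b: "((\<lambda>r. (W r)\<^sup>2) has_real_derivative 2 * (W ?r * W1 ?r)) (at ?r)"
    by (rule derivative_eq_intros dW r refl)+ (simp add: power2_eq_square)
  have c: "((\<lambda>r. (Q r)\<^sup>2) has_real_derivative 2 * (v ?r * W ?r * (Q ?r)\<^sup>2)) (at ?r)"
    by (rule derivative_eq_intros dQ r refl)+ (simp add: power2_eq_square)
  show ?thesis
    unfolding g_nth Let_def
    apply (rule has_grad_eq_rhs)
     apply (rule has_grad_add has_grad_mult has_grad_dt has_grad_dr has_grad_sphere has_grad_radial[OF n a]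
        has_grad_radial[OF n b] has_grad_radial[OF n c] n)+
    apply (simp add: algebra_simps)
    done
qed

lemma g_contract:
  assumes "ynorm2 p \<noteq> 0"
  shows "(\<Sum>m\<in>UNIV. g p $ l $ m * dt_form m p) = - (U (rad p))\<^sup>2 * dt_form l p"
    "(\<Sum>m\<in>UNIV. g p $ l $ m * ycoord m p) = (W (rad p))\<^sup>2 * dr_form l p"
    "(\<Sum>m\<in>UNIV. g p $ l $ m * sphere_proj m i p) = (Q (rad p))\<^sup>2 * sphere_form l i p"
  unfolding g_nth
  by (simp_all add: distrib_right left_diff_distrib sum.distrib sum_subtractf sum_negf mult.assoc
      sum_distrib_left[symmetric] contractions[OF assms])

text \<open>
  Lowering the first index of \<open>conn\<close> gives the Christoffel symbols of the first kind.  This identifies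
  \<open>conn\<close> with the Levi-Civita connection once the metric is inverted.
\<close>

lemma lower_conn:
  assumes "p \<in> shell J"
  shows "pd i (\<lambda>q. g q $ j $ l) p + pd j (\<lambda>q. g q $ i $ l) p - pd l (\<lambda>q. g q $ i $ j) p
    = 2 * (\<Sum>m\<in>UNIV. g p $ l $ m * conn m i j p)"
proof -
  have n: "ynorm2 p \<noteq> 0" and r: "rad p \<in> J" using assms by (auto simp: shell_def)
  show ?thesis
    unfolding conn_contract g_contract[OF n] pd_eq[OF g_has_grad[OF assms]] Let_def
    using nz[OF r]
    by (simp add: field_simps power2_eq_square sphere_form_sym[of j i] sphere_form_sym[of l i] sphere_form_sym[of l j])
qed

definition g_inverse :: "4 \<Rightarrow> 4 \<Rightarrow> point \<Rightarrow> real" where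
  "g_inverse a b p = - dt_form a p * dt_form b p / (U (rad p))\<^sup>2 + ycoord a p * ycoord b p / (W (rad p))\<^sup>2
     + ynorm2 p * sphere_proj a b p / (Q (rad p))\<^sup>2"

lemma g_inverse_g:
  assumes "p \<in> shell J"
  shows "(\<Sum>b\<in>UNIV. g_inverse a b p * g p $ b $ c) = (if a = c then 1 else 0)"
proof -
  have n: "ynorm2 p \<noteq> 0" and r: "rad p \<in> J" using assms by (auto simp: shell_def)
  have gs: "g p $ i $ j = g p $ j $ i" for i j by (simp add: g_nth sphere_form_sym[of i j])
  have sps: "sphere_proj i j p = sphere_proj j i p" for i j by (auto simp: sphere_proj_def dr_form_def)
  have "(\<Sum>b\<in>UNIV. g_inverse a b p * g p $ b $ c) =
    - dt_form a p / (U (rad p))\<^sup>2 * (\<Sum>m\<in>UNIV. g p $ c $ m * dt_form m p)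
    + ycoord a p / (W (rad p))\<^sup>2 * (\<Sum>m\<in>UNIV. g p $ c $ m * ycoord m p)
    + ynorm2 p / (Q (rad p))\<^sup>2 * (\<Sum>m\<in>UNIV. g p $ c $ m * sphere_proj m a p)"
    unfolding g_inverse_def sum_distrib_left
    by (simp add: sum.distrib[symmetric] gs[of c] sps[of a] algebra_simps)
  also have "\<dots> = dt_form a p * dt_form c p + ycoord a p * dr_form c p + ynorm2 p * sphere_form c a p"
    unfolding g_contract[OF n] using nz[OF r] by (simp add: field_simps)
  also have "\<dots> = (if a = c then 1 else 0)"
    using n by (auto simp: dt_form_def sphere_form_def dr_form_def ycoord_def)
  finally show ?thesis .
qed

lemma ginv_eq:
  assumes "p \<in> shell J"
  shows "ginv g a b p = g_inverse a b p"
proof -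
  define N where "N = (\<chi> a b. g_inverse a b p)"
  have l: "N ** g p = mat 1"
    by (simp add: vec_eq_iff matrix_matrix_mult_def mat_def N_def g_inverse_g[OF assms])
  then have r: "g p ** N = mat 1" using matrix_left_right_inverse by blast
  then have inv: "matrix_inv (g p) ** g p = mat 1"
    using l someI[of "\<lambda>A'. g p ** A' = mat 1 \<and> A' ** g p = mat 1" N] unfolding matrix_inv_def by blast
  have "matrix_inv (g p) = matrix_inv (g p) ** (g p ** N)" using r by simp
  also have "\<dots> = N" using inv by (simp add: matrix_mul_assoc)
  finally show ?thesis by (simp add: ginv_def N_def)
qed

lemma christoffel_eq:
  assumes "p \<in> shell J"
  shows "christoffel g k i j p = conn k i j p"
proof -
  have "christoffel g k i j p = (\<Sum>l\<in>UNIV. g_inverse k l p * (\<Sum>m\<in>UNIV. g p $ l $ m * conn m i j p))"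
    unfolding christoffel_def lower_conn[OF assms] ginv_eq[OF assms]
    by (simp add: sum_divide_distrib)
  also have "\<dots> = (\<Sum>m\<in>UNIV. \<Sum>l\<in>UNIV. g_inverse k l p * g p $ l $ m * conn m i j p)"
    unfolding sum_distrib_left by (subst sum.swap) (simp add: mult_ac)
  also have "\<dots> = (\<Sum>m\<in>UNIV. (if k = m then 1 else 0) * conn m i j p)"
    by (simp add: sum_distrib_right[symmetric] g_inverse_g[OF assms])
  also have "\<dots> = conn k i j p" by (simp add: if_distrib[of "\<lambda>x. x * _"] cong: if_cong)
  finally show ?thesis .
qed

lemma conn_has_grad:
  assumes "p \<in> shell J"
  shows "has_grad (conn k i j) (\<lambda>c. let r = rad p in
     dt_form k p * ((u1 r * (W r)\<^sup>2 + u r * W1 r) * dr_form c p * (dt_form i p * dr_form j p + dr_form i p * dt_form j p)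
        + (u r * W r) * (dt_form i p * (sphere_form c j p - dr_form c p * dr_form j p) + (sphere_form c i p - dr_form c p * dr_form i p) * dt_form j p))
   + (sphere_proj k c p + ycoord k p * dr_form c p) * (((U r)\<^sup>2 * u r / W r) * (dt_form i p * dt_form j p)
        + (W1 r / W r - 1) * (dr_form i p * dr_form j p) + (1 - (Q r)\<^sup>2 * v r / W r) * sphere_form i j p)
   + ycoord k p * ((2 * (u r)\<^sup>2 * (U r)\<^sup>2 + (U r)\<^sup>2 * u1 r - (U r)\<^sup>2 * u r * W1 r / (W r)\<^sup>2) * dr_form c p * (dt_form i p * dt_form j p)
        + (W2 r / W r - (W1 r)\<^sup>2 / (W r)\<^sup>2) * dr_form c p * (dr_form i p * dr_form j p)
        + (W1 r / W r - 1) * ((sphere_form c i p - dr_form c p * dr_form i p) * dr_form j p + dr_form i p * (sphere_form c j p - dr_form c p * dr_form j p))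
        - (2 * (v r)\<^sup>2 * (Q r)\<^sup>2 + (Q r)\<^sup>2 * v1 r - (Q r)\<^sup>2 * v r * W1 r / (W r)\<^sup>2) * dr_form c p * sphere_form i j p
        + (1 - (Q r)\<^sup>2 * v r / W r) * (- 2 * dr_form c p * sphere_form i j p - sphere_form c i p * dr_form j p - sphere_form c j p * dr_form i p))
   + (v1 r * (W r)\<^sup>2 + v r * W1 r) * dr_form c p * (sphere_proj k i p * dr_form j p + sphere_proj k j p * dr_form i p)
   + (v r * W r - 1) * ((- sphere_proj k c p * dr_form i p - ycoord k p * sphere_form c i p) * dr_form j p + sphere_proj k i p * (sphere_form c j p - dr_form c p * dr_form j p)
       + (- sphere_proj k c p * dr_form j p - ycoord k p * sphere_form c j p) * dr_form i p + sphere_proj k j p * (sphere_form c i p - dr_form c p * dr_form i p))) p"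
proof -
  have n: "ynorm2 p \<noteq> 0" and r: "rad p \<in> J" using assms by (auto simp: shell_def)
  let ?r = "rad p"
  have a: "((\<lambda>r. u r * W r) has_real_derivative u1 ?r * (W ?r)\<^sup>2 + u ?r * W1 ?r) (at ?r)"
    by (rule derivative_eq_intros dW du r refl)+ (simp add: power2_eq_square)
  have b: "((\<lambda>r. (U r)\<^sup>2 * u r / W r) has_real_derivative
      (2 * (u ?r)\<^sup>2 * (U ?r)\<^sup>2 + (U ?r)\<^sup>2 * u1 ?r - (U ?r)\<^sup>2 * u ?r * W1 ?r / (W ?r)\<^sup>2)) (at ?r)"
    by (rule derivative_eq_intros dW du dU r nz(2)[OF r] refl)+ (simp add: power2_eq_square nz[OF r] field_simps)
  have c: "((\<lambda>r. W1 r / W r - 1) has_real_derivative W2 ?r / W ?r - (W1 ?r)\<^sup>2 / (W ?r)\<^sup>2) (at ?r)"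
    by (rule derivative_eq_intros dW dW1 r nz(2)[OF r] refl)+ (simp add: power2_eq_square nz[OF r] field_simps)
  have d: "((\<lambda>r. 1 - (Q r)\<^sup>2 * v r / W r) has_real_derivative
      - (2 * (v ?r)\<^sup>2 * (Q ?r)\<^sup>2 + (Q ?r)\<^sup>2 * v1 ?r - (Q ?r)\<^sup>2 * v ?r * W1 ?r / (W ?r)\<^sup>2)) (at ?r)"
    by (rule derivative_eq_intros dW dv dQ r nz(2)[OF r] refl)+ (simp add: power2_eq_square nz[OF r] field_simps)
  have f: "((\<lambda>r. v r * W r - 1) has_real_derivative v1 ?r * (W ?r)\<^sup>2 + v ?r * W1 ?r) (at ?r)"
    by (rule derivative_eq_intros dW dv r refl)+ (simp add: power2_eq_square)
  show ?thesis
    unfolding conn_def[abs_def] Let_def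
    apply (rule has_grad_eq_rhs)
     apply (rule has_grad_radial[OF n a] has_grad_radial[OF n b] has_grad_radial[OF n c] has_grad_radial[OF n d] has_grad_radial[OF n f]
        has_grad_add has_grad_mult has_grad_dt has_grad_dr has_grad_sphere has_grad_sphere_proj has_grad_ycoord' n)+
    apply (simp add: algebra_simps)
    done
qed

lemma conn_conn:
  assumes "p \<in> shell J"
  shows "(\<Sum>l\<in>UNIV. conn a c l p * conn l i j p) = (let r = rad p;
      A = u r * W r; B = (U r)\<^sup>2 * u r / W r; C = W1 r / W r - 1; D = 1 - (Q r)\<^sup>2 * v r / W r; F = v r * W r - 1 in
     (dt_form a p * A * dr_form c p + ycoord a p * B * dt_form c p) * (A * (dt_form i p * dr_form j p + dr_form i p * dt_form j p))
   + (dt_form a p * A * dt_form c p + ycoord a p * C * dr_form c p + F * sphere_proj a c p) *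
        (B * (dt_form i p * dt_form j p) + C * (dr_form i p * dr_form j p) + D * sphere_form i j p)
   + F * ((ycoord a p * D * sphere_form c i p + F * sphere_proj a i p * dr_form c p) * dr_form j p
        + (ycoord a p * D * sphere_form c j p + F * sphere_proj a j p * dr_form c p) * dr_form i p))"
proof -
  have n: "ynorm2 p \<noteq> 0" and r: "rad p \<in> J" using assms by (auto simp: shell_def)
  note C = contractions[OF n]
  have 1: "(\<Sum>l\<in>UNIV. conn a c l p * X l) = (let r = rad p in
     dt_form a p * ((u r * W r) * (dt_form c p * (\<Sum>l\<in>UNIV. dr_form l p * X l) + dr_form c p * (\<Sum>l\<in>UNIV. dt_form l p * X l)))
   + ycoord a p * (((U r)\<^sup>2 * u r / W r) * (dt_form c p * (\<Sum>l\<in>UNIV. dt_form l p * X l))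
        + (W1 r / W r - 1) * (dr_form c p * (\<Sum>l\<in>UNIV. dr_form l p * X l)) + (1 - (Q r)\<^sup>2 * v r / W r) * (\<Sum>l\<in>UNIV. sphere_form c l p * X l))
   + (v r * W r - 1) * (sphere_proj a c p * (\<Sum>l\<in>UNIV. dr_form l p * X l) + (\<Sum>l\<in>UNIV. sphere_proj a l p * X l) * dr_form c p))" for X
    unfolding conn_def Let_def
    by (simp add: distrib_left distrib_right sum.distrib sum_distrib_left sum_distrib_right sum_divide_distrib mult_ac)
  show ?thesis
    unfolding conn_contract[of "\<lambda>l. conn a c l p"] unfolding 1 Let_def C by (simp add: algebra_simps)
qed

text \<open>
  Sectional curvatures of the coordinate planes: the \<open>(t,r)\<close>-plane, the planes tangent to the orbit
  spheres, and the mixed planes spanned by a spherical direction and \<open>\<partial>\<^sub>r\<close> or \<open>\<partial>\<^sub>t\<close>.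
\<close>

definition "sec_tr r = - (u1 r + (u r)\<^sup>2)"
definition "sec_sph r = 1 / (Q r)\<^sup>2 - (v r)\<^sup>2"
definition "sec_r_sph r = - (v1 r + (v r)\<^sup>2)"
definition "sec_t_sph r = - u r * v r"

text \<open>
  By symmetry the curvature operator is diagonal on coordinate planes, with the four sectional
  curvatures as eigenvalues.  In the statement \<open>tu\<close>, \<open>ru\<close>, \<open>su\<close> are the \<open>t\<close>-, \<open>r\<close>- and sphere parts of the
  identity, and \<open>tl\<close>, \<open>rl\<close>, \<open>sl\<close> the corresponding parts of the metric.
\<close>

lemma riemann_up_eq:
  assumes "p \<in> shell J"
  shows "riemann_up g a b c d p = (let r = rad p;
     tu = (\<lambda>a c. dt_form a p * dt_form c p); ru = (\<lambda>a c. ycoord a p * dr_form c p); su = (\<lambda>a c. sphere_proj a c p);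
     tl = (\<lambda>a c. - (U r)\<^sup>2 * (dt_form a p * dt_form c p)); rl = (\<lambda>a c. (W r)\<^sup>2 * (dr_form a p * dr_form c p));
     sl = (\<lambda>a c. (Q r)\<^sup>2 * sphere_form a c p) in
       sec_tr r * (tu a c * rl b d + ru a c * tl b d - tu a d * rl b c - ru a d * tl b c)
     + sec_sph r * (su a c * sl b d - su a d * sl b c)
     + sec_r_sph r * (ru a c * sl b d + su a c * rl b d - ru a d * sl b c - su a d * rl b c)
     + sec_t_sph r * (tu a c * sl b d + su a c * tl b d - tu a d * sl b c - su a d * tl b c))"
proof -
  have n: "ynorm2 p \<noteq> 0" and r: "rad p \<in> J" using assms by (auto simp: shell_def)
  have G: "pd k (christoffel g a i j) p = pd k (conn a i j) p" for k a i j
  proof -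
    have "has_grad (christoffel g a i j) (\<lambda>k. pd k (conn a i j) p) p"
      apply (rule has_grad_cong_open[OF _ open_shell[OF J_open] assms])
       apply (rule has_grad_eq_rhs[OF conn_has_grad[OF assms]])
       apply (simp add: pd_eq[OF conn_has_grad[OF assms]])
      apply (simp add: christoffel_eq)
      done
    then show ?thesis by (rule pd_eq)
  qed
  show ?thesis
    unfolding riemann_up_def G christoffel_eq[OF assms] sum_subtractf conn_conn[OF assms]
      pd_eq[OF conn_has_grad[OF assms]] Let_def sec_tr_def sec_sph_def sec_r_sph_def sec_t_sph_def
    using nz[OF r]
    by (simp add: field_simps power2_eq_square sphere_form_sym[of c b] sphere_form_sym[of d b] sphere_form_sym[of d c])
qed

definition e0 :: "4 \<Rightarrow> point \<Rightarrow> real" where "e0 a p = U (rad p) * dt_form a p"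
definition e1 :: "4 \<Rightarrow> point \<Rightarrow> real" where "e1 a p = W (rad p) * dr_form a p"
definition gsph :: "4 \<Rightarrow> 4 \<Rightarrow> point \<Rightarrow> real" where "gsph a b p = (Q (rad p))\<^sup>2 * sphere_form a b p"

lemma g_frame: "g p $ a $ b = - e0 a p * e0 b p + e1 a p * e1 b p + gsph a b p"
  by (simp add: g_nth e0_def e1_def gsph_def power2_eq_square)

text \<open>
  The trace-free part of a diagonal curvature operator with these four eigenvalues: up to scale there
  is only one spherically symmetric Weyl tensor, and this is its coefficient.
\<close>

definition "weyl_coeff r = (sec_tr r + sec_sph r - sec_r_sph r - sec_t_sph r) / 3"

lemma ricci_eq:
  assumes "p \<in> shell J"
  shows "ricci g a b p = (let r = rad p in
    - (sec_tr r + 2 * sec_t_sph r) * e0 a p * e0 b p + (sec_tr r + 2 * sec_r_sph r) * e1 a p * e1 b p + (sec_sph r + sec_r_sph r + sec_t_sph r) * gsph a b p)"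
proof -
  have n: "ynorm2 p \<noteq> 0" and r: "rad p \<in> J" using assms by (auto simp: shell_def)
  note C = contractions[OF n]
  let ?U = "(U (rad p))\<^sup>2" and ?W = "(W (rad p))\<^sup>2" and ?Q = "(Q (rad p))\<^sup>2"
  let ?K = "sec_tr (rad p)" and ?L = "sec_sph (rad p)" and ?p = "sec_r_sph (rad p)" and ?q = "sec_t_sph (rad p)"
  let ?rl = "?W * (dr_form a p * dr_form b p)" and ?tl = "- ?U * (dt_form a p * dt_form b p)" and ?sl = "?Q * sphere_form a b p"
  have "ricci g a b p =
      (\<Sum>k\<in>UNIV. dt_form k p * dt_form k p) * (?K * ?rl + ?q * ?sl)
    - (\<Sum>k\<in>UNIV. dr_form k p * dt_form k p) * (?K * ?W * dr_form a p * dt_form b p)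
    - (\<Sum>k\<in>UNIV. sphere_form a k p * dt_form k p) * (?q * ?Q * dt_form b p)
    + (\<Sum>k\<in>UNIV. dr_form k p * ycoord k p) * (?K * ?tl + ?p * ?sl)
    + (\<Sum>k\<in>UNIV. dt_form k p * ycoord k p) * (?K * ?U * dt_form a p * dr_form b p)
    - (\<Sum>k\<in>UNIV. sphere_form a k p * ycoord k p) * (?p * ?Q * dr_form b p)
    + (\<Sum>k\<in>UNIV. sphere_proj k k p) * (?L * ?sl + ?p * ?rl + ?q * ?tl)
    - (\<Sum>k\<in>UNIV. sphere_form a k p * sphere_proj k b p) * (?L * ?Q)
    - (\<Sum>k\<in>UNIV. dr_form k p * sphere_proj k b p) * (?p * ?W * dr_form a p)
    + (\<Sum>k\<in>UNIV. dt_form k p * sphere_proj k b p) * (?q * ?U * dt_form a p)"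
    unfolding ricci_def riemann_up_eq[OF assms] Let_def
    by (simp add: sum_distrib_left sum_distrib_right sum.distrib sum_subtractf sum_negf distrib_left distrib_right
        right_diff_distrib left_diff_distrib mult_ac)
  then show ?thesis
    unfolding C Let_def e0_def e1_def gsph_def by (simp add: algebra_simps power2_eq_square)
qed

lemma g_inverse_contract:
  assumes "p \<in> shell J"
  shows "(\<Sum>b\<in>UNIV. g_inverse a b p * dt_form b p) = - dt_form a p / (U (rad p))\<^sup>2"
    "(\<Sum>b\<in>UNIV. g_inverse a b p * dr_form b p) = ycoord a p / (W (rad p))\<^sup>2"
    "(\<Sum>b\<in>UNIV. g_inverse a b p * sphere_form b c p) = sphere_proj a c p / (Q (rad p))\<^sup>2"
proof -
  have n: "ynorm2 p \<noteq> 0" and r: "rad p \<in> J" using assms by (auto simp: shell_def)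
  note C = contractions[OF n]
  have s: "sphere_form i k p = sphere_form k i p" "sphere_proj i k p = sphere_proj k i p" for i k
    by (auto simp: sphere_form_sym sphere_proj_def dr_form_def)
  have n': "ynorm2 p * sphere_form a c p = sphere_proj a c p"
    using n by (auto simp: sphere_form_def sphere_proj_def dr_form_def ycoord_def)
  have G: "(\<Sum>b\<in>UNIV. g_inverse a b p * X b) = - dt_form a p / (U (rad p))\<^sup>2 * (\<Sum>b\<in>UNIV. X b * dt_form b p)
      + ycoord a p / (W (rad p))\<^sup>2 * (\<Sum>b\<in>UNIV. X b * ycoord b p)
      + ynorm2 p / (Q (rad p))\<^sup>2 * (\<Sum>b\<in>UNIV. X b * sphere_proj b a p)" for X
    unfolding g_inverse_def sum_distrib_left
    by (simp add: sum.distrib[symmetric] s(2)[of a] algebra_simps)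
  show "(\<Sum>b\<in>UNIV. g_inverse a b p * dt_form b p) = - dt_form a p / (U (rad p))\<^sup>2"
    "(\<Sum>b\<in>UNIV. g_inverse a b p * dr_form b p) = ycoord a p / (W (rad p))\<^sup>2"
    "(\<Sum>b\<in>UNIV. g_inverse a b p * sphere_form b c p) = sphere_proj a c p / (Q (rad p))\<^sup>2"
    unfolding G s(1)[of _ c] C using n' by (simp_all add: s[of c a])
qed

lemma scalar_eq:
  assumes "p \<in> shell J"
  shows "scalar_curv g p = (let r = rad p in 2 * sec_tr r + 2 * sec_sph r + 4 * sec_r_sph r + 4 * sec_t_sph r)"
proof -
  have n: "ynorm2 p \<noteq> 0" and r: "rad p \<in> J" using assms by (auto simp: shell_def)
  note C = contractions[OF n]
  have "(\<Sum>b\<in>UNIV. g_inverse a b p * (- x * e0 a p * e0 b p + y * e1 a p * e1 b p + z * gsph a b p))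
    = - x * e0 a p * U (rad p) * (\<Sum>b\<in>UNIV. g_inverse a b p * dt_form b p)
      + y * e1 a p * W (rad p) * (\<Sum>b\<in>UNIV. g_inverse a b p * dr_form b p)
      + z * (Q (rad p))\<^sup>2 * (\<Sum>b\<in>UNIV. g_inverse a b p * sphere_form b a p)" for a x y z
    unfolding sum_distrib_left e0_def e1_def gsph_def
    by (simp add: sum.distrib[symmetric] sphere_form_sym[of a] algebra_simps)
  also have "\<dots> a x y z = x * (dt_form a p * dt_form a p) + y * (dr_form a p * ycoord a p) + z * sphere_proj a a p" for a x y z
    unfolding g_inverse_contract[OF assms] using nz[OF r] by (simp add: e0_def e1_def power2_eq_square)
  finally have X: "(\<Sum>b\<in>UNIV. g_inverse a b p * (- x * e0 a p * e0 b p + y * e1 a p * e1 b p + z * gsph a b p))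
    = x * (dt_form a p * dt_form a p) + y * (dr_form a p * ycoord a p) + z * sphere_proj a a p" for a x y z .
  show ?thesis
    unfolding scalar_curv_def ricci_eq[OF assms] ginv_eq[OF assms] Let_def X sum.distrib sum_distrib_left[symmetric] C
    by simp
qed

text \<open>
  As a vector in its first index the curvature is a combination of \<open>\<partial>\<^sub>t\<close>, the radial vector and two
  spherical projections, so lowering this index needs only the three contractions in \<open>g_contract\<close>.
\<close>

lemma riemann_eq:
  assumes "p \<in> shell J"
  shows "riemann g a b c d p = (let r = rad p;
     tl = (\<lambda>a c. - (e0 a p * e0 c p)); rl = (\<lambda>a c. e1 a p * e1 c p);
     sl = (\<lambda>a c. gsph a c p) in
       sec_tr r * (tl a c * rl b d + rl a c * tl b d - tl a d * rl b c - rl a d * tl b c)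
     + sec_sph r * (sl a c * sl b d - sl a d * sl b c)
     + sec_r_sph r * (rl a c * sl b d + sl a c * rl b d - rl a d * sl b c - sl a d * rl b c)
     + sec_t_sph r * (tl a c * sl b d + sl a c * tl b d - tl a d * sl b c - sl a d * tl b c))"
proof -
  have n: "ynorm2 p \<noteq> 0" using assms by (auto simp: shell_def)
  let ?r = "rad p"
  let ?tl = "\<lambda>a c. - (U ?r)\<^sup>2 * (dt_form a p * dt_form c p)" and ?rl = "\<lambda>a c. (W ?r)\<^sup>2 * (dr_form a p * dr_form c p)"
  let ?sl = "\<lambda>a c. (Q ?r)\<^sup>2 * sphere_form a c p"
  define \<alpha> where "\<alpha> = sec_tr ?r * (dt_form c p * ?rl b d - dt_form d p * ?rl b c) + sec_t_sph ?r * (dt_form c p * ?sl b d - dt_form d p * ?sl b c)"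
  define \<beta> where "\<beta> = sec_tr ?r * (dr_form c p * ?tl b d - dr_form d p * ?tl b c) + sec_r_sph ?r * (dr_form c p * ?sl b d - dr_form d p * ?sl b c)"
  define \<gamma> where "\<gamma> = (\<lambda>d. sec_sph ?r * ?sl b d + sec_r_sph ?r * ?rl b d + sec_t_sph ?r * ?tl b d)"
  have "riemann_up g e b c d p = dt_form e p * \<alpha> + ycoord e p * \<beta> + sphere_proj e c p * \<gamma> d - sphere_proj e d p * \<gamma> c" for e
    unfolding riemann_up_eq[OF assms] Let_def \<alpha>_def \<beta>_def \<gamma>_def by (simp add: algebra_simps)
  then have "riemann g a b c d p = (\<Sum>m\<in>UNIV. g p $ a $ m * dt_form m p) * \<alpha> + (\<Sum>m\<in>UNIV. g p $ a $ m * ycoord m p) * \<beta>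
    + (\<Sum>m\<in>UNIV. g p $ a $ m * sphere_proj m c p) * \<gamma> d - (\<Sum>m\<in>UNIV. g p $ a $ m * sphere_proj m d p) * \<gamma> c"
    unfolding riemann_def by (simp add: distrib_left right_diff_distrib sum.distrib sum_subtractf sum_distrib_right mult.assoc)
  then show ?thesis
    unfolding g_contract[OF n] Let_def \<alpha>_def \<beta>_def \<gamma>_def e0_def e1_def gsph_def
    by (simp add: power2_eq_square algebra_simps)
qed

lemma weyl_eq:
  assumes "p \<in> shell J"
  shows "weyl g a b c d p = weyl_coeff (rad p) * (let
     h = (\<lambda>a c. - (e0 a p * e0 c p) + e1 a p * e1 c p); sl = (\<lambda>a c. gsph a c p) in
       (h a c * h b d - h a d * h b c) + (sl a c * sl b d - sl a d * sl b c)
     - (h a c * sl b d + sl a c * h b d - h a d * sl b c - sl a d * h b c) / 2)"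
  unfolding weyl_def ricci_eq[OF assms] scalar_eq[OF assms] riemann_eq[OF assms] g_frame Let_def weyl_coeff_def
  by (simp add: field_simps)

end

section \<open>Covariant differentiation as a derivation\<close>

text \<open>
  The predicate \<open>cov\<close>\<open>n\<close> says that the rank \<open>n\<close> covariant tensor field \<open>T\<close> has covariant derivative
  \<open>T'\<close> at \<open>p\<close>, for connection coefficients \<open>G\<close> at \<open>p\<close>; the new index of \<open>T'\<close> comes first.  It is phrased
  as a formula for the gradient of \<open>T\<close>, so that the product rule for \<open>has_grad\<close> yields the Leibniz rule
  for tensor products.
\<close>

definition cov1 :: "(4\<Rightarrow>4\<Rightarrow>4\<Rightarrow>real) \<Rightarrow> (4\<Rightarrow>point\<Rightarrow>real) \<Rightarrow> (4\<Rightarrow>4\<Rightarrow>real) \<Rightarrow> point \<Rightarrow> bool" where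
  "cov1 G T T' p \<longleftrightarrow> (\<forall>a. has_grad (T a) (\<lambda>e. T' e a + (\<Sum>l\<in>UNIV. G l e a * T l p)) p)"
definition cov2 :: "(4\<Rightarrow>4\<Rightarrow>4\<Rightarrow>real) \<Rightarrow> (4\<Rightarrow>4\<Rightarrow>point\<Rightarrow>real) \<Rightarrow> (4\<Rightarrow>4\<Rightarrow>4\<Rightarrow>real) \<Rightarrow> point \<Rightarrow> bool" where
  "cov2 G T T' p \<longleftrightarrow> (\<forall>a b. has_grad (T a b) (\<lambda>e. T' e a b + (\<Sum>l\<in>UNIV. G l e a * T l b p + G l e b * T a l p)) p)"
definition cov3 :: "(4\<Rightarrow>4\<Rightarrow>4\<Rightarrow>real) \<Rightarrow> (4\<Rightarrow>4\<Rightarrow>4\<Rightarrow>point\<Rightarrow>real) \<Rightarrow> (4\<Rightarrow>4\<Rightarrow>4\<Rightarrow>4\<Rightarrow>real) \<Rightarrow> point \<Rightarrow> bool" where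
  "cov3 G T T' p \<longleftrightarrow> (\<forall>a b c. has_grad (T a b c) (\<lambda>e. T' e a b c +
     (\<Sum>l\<in>UNIV. G l e a * T l b c p + G l e b * T a l c p + G l e c * T a b l p)) p)"
definition cov4 :: "(4\<Rightarrow>4\<Rightarrow>4\<Rightarrow>real) \<Rightarrow> (4\<Rightarrow>4\<Rightarrow>4\<Rightarrow>4\<Rightarrow>point\<Rightarrow>real) \<Rightarrow> (4\<Rightarrow>4\<Rightarrow>4\<Rightarrow>4\<Rightarrow>4\<Rightarrow>real) \<Rightarrow> point \<Rightarrow> bool" where
  "cov4 G T T' p \<longleftrightarrow> (\<forall>a b c d. has_grad (T a b c d) (\<lambda>e. T' e a b c d +
     (\<Sum>l\<in>UNIV. G l e a * T l b c d p + G l e b * T a l c d p + G l e c * T a b l d p + G l e d * T a b c l p)) p)"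
definition cov5 :: "(4\<Rightarrow>4\<Rightarrow>4\<Rightarrow>real) \<Rightarrow> (4\<Rightarrow>4\<Rightarrow>4\<Rightarrow>4\<Rightarrow>4\<Rightarrow>point\<Rightarrow>real) \<Rightarrow> (4\<Rightarrow>4\<Rightarrow>4\<Rightarrow>4\<Rightarrow>4\<Rightarrow>4\<Rightarrow>real) \<Rightarrow> point \<Rightarrow> bool" where
  "cov5 G T T' p \<longleftrightarrow> (\<forall>e a b c d. has_grad (T e a b c d) (\<lambda>f. T' f e a b c d +
     (\<Sum>l\<in>UNIV. G l f e * T l a b c d p + G l f a * T e l b c d p + G l f b * T e a l c d p
         + G l f c * T e a b l d p + G l f d * T e a b c l p)) p)"

lemmas cov_defs = cov1_def cov2_def cov3_def cov4_def cov5_def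
lemmas cov_push = sum_distrib_left sum_distrib_right sum.distrib sum_subtractf sum_negf distrib_left distrib_right
        right_diff_distrib left_diff_distrib

lemma cov2_mult:
  assumes "cov1 G A A' p" "cov1 G B B' p"
  shows "cov2 G (\<lambda>a b q. A a q * B b q) (\<lambda>e a b. A' e a * B b p + A a p * B' e b) p"
  unfolding cov_defs
proof (intro allI)
  fix a b
  show "has_grad (\<lambda>q. A a q * B b q) (\<lambda>e. A' e a * B b p + A a p * B' e b +
            (\<Sum>l\<in>UNIV. G l e a * (A l p * B b p) + G l e b * (A a p * B l p))) p"
    by (rule has_grad_eq_rhs[OF has_grad_mult[OF assms[unfolded cov_defs, rule_format]]])
      (simp add: cov_push mult_ac)
qed

text \<open>
  Besides the plain tensor product, the Leibniz rule is recorded for each way of distributing the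
  indices over the factors that occurs in the Weyl tensor and its first derivative.
\<close>

lemma cov3_mult:
  assumes "cov1 G A A' p" "cov2 G B B' p"
  shows "cov3 G (\<lambda>a b c q. A b q * B a c q) (\<lambda>e a b c. A' e b * B a c p + A b p * B' e a c) p"
    "cov3 G (\<lambda>a b c q. A c q * B a b q) (\<lambda>e a b c. A' e c * B a b p + A c p * B' e a b) p"
  unfolding cov_defs
  by (intro allI; rule has_grad_eq_rhs[OF has_grad_mult[OF assms[unfolded cov_defs, rule_format]]];
      simp add: cov_push mult_ac)+

lemma cov4_mult:
  assumes "cov2 G A A' p" "cov2 G B B' p"
  shows "cov4 G (\<lambda>a b c d q. A a b q * B c d q) (\<lambda>e a b c d. A' e a b * B c d p + A a b p * B' e c d) p"
    "cov4 G (\<lambda>a b c d q. A a c q * B b d q) (\<lambda>e a b c d. A' e a c * B b d p + A a c p * B' e b d) p"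
    "cov4 G (\<lambda>a b c d q. A a d q * B b c q) (\<lambda>e a b c d. A' e a d * B b c p + A a d p * B' e b c) p"
    "cov4 G (\<lambda>a b c d q. A b c q * B a d q) (\<lambda>e a b c d. A' e b c * B a d p + A b c p * B' e a d) p"
    "cov4 G (\<lambda>a b c d q. A b d q * B a c q) (\<lambda>e a b c d. A' e b d * B a c p + A b d p * B' e a c) p"
  unfolding cov_defs
  by (intro allI; rule has_grad_eq_rhs[OF has_grad_mult[OF assms[unfolded cov_defs, rule_format]]];
      simp add: cov_push mult_ac)+

lemma cov5_mult:
  assumes "cov3 G A A' p" "cov2 G B B' p"
  shows "cov5 G (\<lambda>e a b c d q. A e a b q * B c d q) (\<lambda>f e a b c d. A' f e a b * B c d p + A e a b p * B' f c d) p"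
    "cov5 G (\<lambda>e a b c d q. A e c d q * B a b q) (\<lambda>f e a b c d. A' f e c d * B a b p + A e c d p * B' f a b) p"
    "cov5 G (\<lambda>e a b c d q. A e b d q * B a c q) (\<lambda>f e a b c d. A' f e b d * B a c p + A e b d p * B' f a c) p"
    "cov5 G (\<lambda>e a b c d q. A e b c q * B a d q) (\<lambda>f e a b c d. A' f e b c * B a d p + A e b c p * B' f a d) p"
    "cov5 G (\<lambda>e a b c d q. A e a d q * B b c q) (\<lambda>f e a b c d. A' f e a d * B b c p + A e a d p * B' f b c) p"
    "cov5 G (\<lambda>e a b c d q. A e a c q * B b d q) (\<lambda>f e a b c d. A' f e a c * B b d p + A e a c p * B' f b d) p"
  unfolding cov_defs
  by (intro allI; rule has_grad_eq_rhs[OF has_grad_mult[OF assms[unfolded cov_defs, rule_format]]];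
      simp add: cov_push mult_ac)+

lemma cov5_mult14:
  assumes "cov1 G A A' p" "cov4 G B B' p"
  shows "cov5 G (\<lambda>e a b c d q. A e q * B a b c d q) (\<lambda>f e a b c d. A' f e * B a b c d p + A e p * B' f a b c d) p"
  unfolding cov_defs
  by (intro allI; rule has_grad_eq_rhs[OF has_grad_mult[OF assms[unfolded cov_defs, rule_format]]];
      simp add: cov_push mult_ac)

lemma cov_scale:
  assumes "has_grad f f' p"
  shows "cov4 G T4 T4' p \<Longrightarrow> cov4 G (\<lambda>a b c d q. f q * T4 a b c d q) (\<lambda>e a b c d. f' e * T4 a b c d p + f p * T4' e a b c d) p"
    "cov5 G T5 T5' p \<Longrightarrow> cov5 G (\<lambda>e a b c d q. f q * T5 e a b c d q) (\<lambda>g e a b c d. f' g * T5 e a b c d p + f p * T5' g e a b c d) p"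
  unfolding cov_defs
  by (intro allI; rule has_grad_eq_rhs[OF has_grad_mult[OF assms]], assumption?, (drule spec)+, assumption;
      simp add: cov_push mult_ac)+

lemma cov_add:
  "cov2 G T2 T2' p \<Longrightarrow> cov2 G R2 R2' p \<Longrightarrow> cov2 G (\<lambda>a b q. T2 a b q + R2 a b q) (\<lambda>e a b. T2' e a b + R2' e a b) p"
  "cov3 G T3 T3' p \<Longrightarrow> cov3 G R3 R3' p \<Longrightarrow> cov3 G (\<lambda>a b c q. T3 a b c q + R3 a b c q) (\<lambda>e a b c. T3' e a b c + R3' e a b c) p"
  "cov4 G T4 T4' p \<Longrightarrow> cov4 G R4 R4' p \<Longrightarrow> cov4 G (\<lambda>a b c d q. T4 a b c d q + R4 a b c d q) (\<lambda>e a b c d. T4' e a b c d + R4' e a b c d) p"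
  "cov5 G T5 T5' p \<Longrightarrow> cov5 G R5 R5' p \<Longrightarrow> cov5 G (\<lambda>e a b c d q. T5 e a b c d q + R5 e a b c d q) (\<lambda>f e a b c d. T5' f e a b c d + R5' f e a b c d) p"
  unfolding cov_defs
  by (intro allI; rule has_grad_eq_rhs, rule has_grad_add, (drule spec)+, assumption, (drule spec)+, assumption;
      simp add: cov_push mult_ac)+

lemma cov_diff:
  "cov2 G T2 T2' p \<Longrightarrow> cov2 G R2 R2' p \<Longrightarrow> cov2 G (\<lambda>a b q. T2 a b q - R2 a b q) (\<lambda>e a b. T2' e a b - R2' e a b) p"
  "cov3 G T3 T3' p \<Longrightarrow> cov3 G R3 R3' p \<Longrightarrow> cov3 G (\<lambda>a b c q. T3 a b c q - R3 a b c q) (\<lambda>e a b c. T3' e a b c - R3' e a b c) p"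
  "cov4 G T4 T4' p \<Longrightarrow> cov4 G R4 R4' p \<Longrightarrow> cov4 G (\<lambda>a b c d q. T4 a b c d q - R4 a b c d q) (\<lambda>e a b c d. T4' e a b c d - R4' e a b c d) p"
  "cov5 G T5 T5' p \<Longrightarrow> cov5 G R5 R5' p \<Longrightarrow> cov5 G (\<lambda>e a b c d q. T5 e a b c d q - R5 e a b c d q) (\<lambda>f e a b c d. T5' f e a b c d - R5' f e a b c d) p"
  unfolding cov_defs
  by (intro allI; rule has_grad_eq_rhs, rule has_grad_diff, (drule spec)+, assumption, (drule spec)+, assumption;
      simp add: cov_push mult_ac)+

lemma cov_eq_rhs:
  "cov2 G T2 T2' p \<Longrightarrow> (\<And>e a b. T2' e a b = R2 e a b) \<Longrightarrow> cov2 G T2 R2 p"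
  "cov3 G T3 T3' p \<Longrightarrow> (\<And>e a b c. T3' e a b c = R3 e a b c) \<Longrightarrow> cov3 G T3 R3 p"
  "cov4 G T4 T4' p \<Longrightarrow> (\<And>e a b c d. T4' e a b c d = R4 e a b c d) \<Longrightarrow> cov4 G T4 R4 p"
  "cov5 G T5 T5' p \<Longrightarrow> (\<And>f e a b c d. T5' f e a b c d = R5 f e a b c d) \<Longrightarrow> cov5 G T5 R5 p"
  by (simp_all add: cov_defs)

lemma nabla4_eq:
  assumes "cov4 (\<lambda>k i j. christoffel g k i j p) T T' p"
  shows "nabla4 g T e a b c d p = T' e a b c d"
  using pd_eq[OF assms[unfolded cov4_def, rule_format, of a b c d], of e] unfolding nabla4_def by simp

lemma nabla5_eq:
  assumes "cov5 (\<lambda>k i j. christoffel g k i j p) T T' p"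
  shows "nabla5 g T f e a b c d p = T' f e a b c d"
  using pd_eq[OF assms[unfolded cov5_def, rule_format, of e a b c d], of f] unfolding nabla5_def by simp

lemma cov4_cong_open:
  assumes "cov4 G T T' p" "open V" "p \<in> V" "\<And>a b c d q. q \<in> V \<Longrightarrow> T a b c d q = R a b c d q"
  shows "cov4 G R T' p"
  unfolding cov4_def
proof (intro allI)
  fix a b c d
  from has_grad_cong_open[OF assms(1)[unfolded cov4_def, rule_format, of a b c d] assms(2,3) assms(4)]
  show "has_grad (R a b c d) (\<lambda>e. T' e a b c d +
      (\<Sum>l\<in>UNIV. G l e a * R l b c d p + G l e b * R a l c d p + G l e c * R a b l d p + G l e d * R a b c l p)) p"
    using assms(4)[OF assms(3)] by simp
qed

lemma cov5_cong_open:
  assumes "cov5 G T T' p" "open V" "p \<in> V" "\<And>e a b c d q. q \<in> V \<Longrightarrow> T e a b c d q = R e a b c d q"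
  shows "cov5 G R T' p"
  unfolding cov5_def
proof (intro allI)
  fix e a b c d
  from has_grad_cong_open[OF assms(1)[unfolded cov5_def, rule_format, of e a b c d] assms(2,3) assms(4)]
  show "has_grad (R e a b c d) (\<lambda>f. T' f e a b c d +
      (\<Sum>l\<in>UNIV. G l f e * R l a b c d p + G l f a * R e l b c d p + G l f b * R e a l c d p
         + G l f c * R e a b l d p + G l f d * R e a b c l p)) p"
    using assms(4)[OF assms(3)] by simp
qed

section \<open>The second covariant derivative of the Weyl tensor\<close>

context warped
begin

abbreviation "Gam p \<equiv> (\<lambda>k i j. christoffel g k i j p)"

text \<open>
  In the frame \<open>e0\<close>, \<open>e1\<close> the connection has only the coefficients \<open>u\<close> (boosts in the \<open>(t,r)\<close>-plane) and
  \<open>v\<close> (expansion of the spheres).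
\<close>

lemma cov_e0:
  assumes p: "p \<in> shell J"
  shows "cov1 (Gam p) e0 (\<lambda>e a. - u (rad p) * (e0 e p * e1 a p)) p"
proof -
  have n: "ynorm2 p \<noteq> 0" and r: "rad p \<in> J" using p by (auto simp: shell_def)
  have 1: "(\<Sum>l\<in>UNIV. conn l e a p * e0 l p) = U (rad p) * (\<Sum>l\<in>UNIV. dt_form l p * conn l e a p)" for e a
    by (simp add: e0_def sum_distrib_left mult_ac)
  show ?thesis
    unfolding cov1_def christoffel_eq[OF p] 1 conn_contract contractions[OF n]
    apply (intro allI)
    apply (simp only: e0_def[abs_def])
    apply (rule has_grad_eq_rhs)
     apply (rule has_grad_mult has_grad_dt has_grad_radial n dU r)+
    apply (simp add: e1_def algebra_simps)
    done
qed

lemma cov_e1: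
  assumes p: "p \<in> shell J"
  shows "cov1 (Gam p) e1 (\<lambda>e a. - u (rad p) * (e0 e p * e0 a p) + v (rad p) * gsph e a p) p"
proof -
  have n: "ynorm2 p \<noteq> 0" and r: "rad p \<in> J" using p by (auto simp: shell_def)
  have 1: "(\<Sum>l\<in>UNIV. conn l e a p * e1 l p) = W (rad p) * (\<Sum>l\<in>UNIV. dr_form l p * conn l e a p)" for e a
    by (simp add: e1_def sum_distrib_left mult_ac)
  show ?thesis
    unfolding cov1_def christoffel_eq[OF p] 1 conn_contract contractions[OF n]
    apply (intro allI)
    apply (simp only: e1_def[abs_def])
    apply (rule has_grad_eq_rhs)
     apply (rule has_grad_mult has_grad_dr has_grad_radial n dW r)+
    apply (use nz[OF r] in \<open>simp add: e0_def gsph_def field_simps power2_eq_square\<close>)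
    done
qed

lemma cov_gsph:
  assumes p: "p \<in> shell J"
  shows "cov2 (Gam p) gsph (\<lambda>e a b. - v (rad p) * (gsph e a p * e1 b p + gsph e b p * e1 a p)) p"
proof -
  have n: "ynorm2 p \<noteq> 0" and r: "rad p \<in> J" using p by (auto simp: shell_def)
  have 1: "(\<Sum>l\<in>UNIV. conn l e a p * gsph l b p + conn l e b p * gsph a l p)
    = (Q (rad p))\<^sup>2 * ((\<Sum>l\<in>UNIV. sphere_form b l p * conn l e a p) + (\<Sum>l\<in>UNIV. sphere_form a l p * conn l e b p))" for e a b
    by (simp add: gsph_def sum_distrib_left sum.distrib mult_ac sphere_form_sym[of _ b] distrib_left)
  have c: "((\<lambda>r. (Q r)\<^sup>2) has_real_derivative 2 * (v (rad p) * W (rad p) * (Q (rad p))\<^sup>2)) (at (rad p))"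
    by (rule derivative_eq_intros dQ r refl)+ (simp add: power2_eq_square)
  show ?thesis
    unfolding cov2_def christoffel_eq[OF p] 1 conn_contract contractions[OF n]
    apply (intro allI)
    apply (simp only: gsph_def[abs_def])
    apply (rule has_grad_eq_rhs)
     apply (rule has_grad_mult has_grad_sphere has_grad_radial[OF n c] n)+
    apply (use nz[OF r] in \<open>simp add: e1_def field_simps power2_eq_square sphere_form_sym\<close>)
    done
qed

text \<open>
  The metric splits as \<open>gfull = gtr + gsph\<close>, where \<open>gtr\<close> is its Lorentzian part and \<open>vol\<close> the area form
  of that part.  Since \<open>gfull\<close> is parallel, it costs nothing to write tensors in terms of \<open>gfull\<close>, \<open>gtr\<close>
  and \<open>vol\<close>; the derivatives of the last two are \<open>v\<close> times \<open>dgtr\<close> and \<open>v\<close> times \<open>dvol\<close>.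
\<close>

definition gtr :: "4 \<Rightarrow> 4 \<Rightarrow> point \<Rightarrow> real" where "gtr a b p = e1 a p * e1 b p - e0 a p * e0 b p"
definition gfull :: "4 \<Rightarrow> 4 \<Rightarrow> point \<Rightarrow> real" where "gfull a b p = gtr a b p + gsph a b p"
definition vol :: "4 \<Rightarrow> 4 \<Rightarrow> point \<Rightarrow> real" where "vol a b p = e0 a p * e1 b p - e1 a p * e0 b p"
definition dgtr :: "4 \<Rightarrow> 4 \<Rightarrow> 4 \<Rightarrow> point \<Rightarrow> real" where "dgtr e a b p = e1 b p * gsph e a p + e1 a p * gsph e b p"
definition dvol :: "4 \<Rightarrow> 4 \<Rightarrow> 4 \<Rightarrow> point \<Rightarrow> real" where "dvol e a b p = e0 a p * gsph e b p - e0 b p * gsph e a p"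

lemma cov_gtr:
  assumes p: "p \<in> shell J"
  shows "cov2 (Gam p) gtr (\<lambda>e a b. v (rad p) * dgtr e a b p) p"
  unfolding gtr_def[abs_def]
  by (rule cov_eq_rhs(1)[OF cov_diff(1)[OF cov2_mult[OF cov_e1[OF p] cov_e1[OF p]] cov2_mult[OF cov_e0[OF p] cov_e0[OF p]]]])
    (simp add: dgtr_def algebra_simps)

lemma cov_gfull:
  assumes p: "p \<in> shell J"
  shows "cov2 (Gam p) gfull (\<lambda>e a b. 0) p"
  unfolding gfull_def[abs_def]
  by (rule cov_eq_rhs(1)[OF cov_add(1)[OF cov_gtr[OF p] cov_gsph[OF p]]])
    (simp add: dgtr_def algebra_simps)

lemma cov_vol:
  assumes p: "p \<in> shell J"
  shows "cov2 (Gam p) vol (\<lambda>e a b. v (rad p) * dvol e a b p) p"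
  unfolding vol_def[abs_def]
  by (rule cov_eq_rhs(1)[OF cov_diff(1)[OF cov2_mult[OF cov_e0[OF p] cov_e1[OF p]] cov2_mult[OF cov_e1[OF p] cov_e0[OF p]]]])
    (simp add: dvol_def algebra_simps)

text \<open>The covariant derivatives of \<open>dgtr\<close> and \<open>dvol\<close>.\<close>

definition ddgtr :: "4 \<Rightarrow> 4 \<Rightarrow> 4 \<Rightarrow> 4 \<Rightarrow> point \<Rightarrow> real" where
  "ddgtr f e a b p = (- u (rad p) * (e0 f p * e0 b p) + v (rad p) * gsph f b p) * gsph e a p
      - e1 b p * (v (rad p) * (gsph f e p * e1 a p + gsph f a p * e1 e p))
      + (- u (rad p) * (e0 f p * e0 a p) + v (rad p) * gsph f a p) * gsph e b p
      - e1 a p * (v (rad p) * (gsph f e p * e1 b p + gsph f b p * e1 e p))"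
definition ddvol :: "4 \<Rightarrow> 4 \<Rightarrow> 4 \<Rightarrow> 4 \<Rightarrow> point \<Rightarrow> real" where
  "ddvol f e a b p = - u (rad p) * (e0 f p * e1 a p) * gsph e b p
      - e0 a p * (v (rad p) * (gsph f e p * e1 b p + gsph f b p * e1 e p))
      + u (rad p) * (e0 f p * e1 b p) * gsph e a p
      + e0 b p * (v (rad p) * (gsph f e p * e1 a p + gsph f a p * e1 e p))"

lemma cov_dgtr:
  assumes p: "p \<in> shell J"
  shows "cov3 (Gam p) dgtr (\<lambda>f e a b. ddgtr f e a b p) p"
  unfolding dgtr_def[abs_def]
  by (rule cov_eq_rhs(2)[OF cov_add(2)[OF cov3_mult(2)[OF cov_e1[OF p] cov_gsph[OF p]] cov3_mult(1)[OF cov_e1[OF p] cov_gsph[OF p]]]])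
    (simp add: ddgtr_def algebra_simps)

lemma cov_dvol:
  assumes p: "p \<in> shell J"
  shows "cov3 (Gam p) dvol (\<lambda>f e a b. ddvol f e a b p) p"
  unfolding dvol_def[abs_def]
  by (rule cov_eq_rhs(2)[OF cov_diff(2)[OF cov3_mult(1)[OF cov_e0[OF p] cov_gsph[OF p]] cov3_mult(2)[OF cov_e0[OF p] cov_gsph[OF p]]]])
    (simp add: ddvol_def algebra_simps)

text \<open>
  The Weyl tensor divided by its coefficient.  In the metric parts it is
  \<open>gtr\<and>gtr/2 + gsph\<and>gsph/2 - gtr\<and>gsph/2\<close> with the Kulkarni--Nomizu product \<open>\<and>\<close>; replacing \<open>gsph\<close> by
  \<open>gfull - gtr\<close> and \<open>gtr\<and>gtr/2\<close> by \<open>-vol\<otimes>vol\<close> gives the present form, with few factors that are not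
  parallel.  The derivative of \<open>shape\<close> is \<open>v\<close> times \<open>dshape\<close>, and that of \<open>dshape\<close> is \<open>ddshape\<close>.
\<close>

definition shape :: "4 \<Rightarrow> 4 \<Rightarrow> 4 \<Rightarrow> 4 \<Rightarrow> point \<Rightarrow> real" where
  "shape a b c d p = gfull a c p * gfull b d p - gfull a d p * gfull b c p - 3 * (vol a b p * vol c d p)
     - 3/2 * (gtr a c p * gfull b d p - gtr a d p * gfull b c p - gtr b c p * gfull a d p + gtr b d p * gfull a c p)"

definition dshape :: "4 \<Rightarrow> 4 \<Rightarrow> 4 \<Rightarrow> 4 \<Rightarrow> 4 \<Rightarrow> point \<Rightarrow> real" where
  "dshape e a b c d p = - 3 * (dvol e a b p * vol c d p + dvol e c d p * vol a b p)
     - 3/2 * (dgtr e a c p * gfull b d p - dgtr e a d p * gfull b c p - dgtr e b c p * gfull a d p + dgtr e b d p * gfull a c p)"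

definition ddshape :: "4 \<Rightarrow> 4 \<Rightarrow> 4 \<Rightarrow> 4 \<Rightarrow> 4 \<Rightarrow> 4 \<Rightarrow> point \<Rightarrow> real" where
  "ddshape f e a b c d p = - 3 * (ddvol f e a b p * vol c d p + v (rad p) * (dvol e a b p * dvol f c d p)
        + ddvol f e c d p * vol a b p + v (rad p) * (dvol e c d p * dvol f a b p))
     - 3/2 * (ddgtr f e a c p * gfull b d p - ddgtr f e a d p * gfull b c p - ddgtr f e b c p * gfull a d p + ddgtr f e b d p * gfull a c p)"

lemma weyl_shape:
  assumes p: "p \<in> shell J"
  shows "weyl g a b c d p = weyl_coeff (rad p) * shape a b c d p"
  unfolding weyl_eq[OF p] Let_def shape_def gfull_def gtr_def vol_def
  by (simp add: field_simps)

lemma cov_shape: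
  assumes p: "p \<in> shell J"
  shows "cov4 (Gam p) shape (\<lambda>e a b c d. v (rad p) * dshape e a b c d p) p"
proof -
  note g = cov_gfull[OF p] and gtr = cov_gtr[OF p] and vol = cov_vol[OF p]
  show ?thesis
    unfolding shape_def[abs_def]
    by (rule cov_eq_rhs(3)[OF cov_diff(3)[OF cov_diff(3)[OF cov_diff(3)[OF cov4_mult(2)[OF g g] cov4_mult(3)[OF g g]]
          cov_scale(1)[OF has_grad_const cov4_mult(1)[OF vol vol]]]
          cov_scale(1)[OF has_grad_const cov_add(3)[OF cov_diff(3)[OF cov_diff(3)[OF cov4_mult(2)[OF gtr g] cov4_mult(3)[OF gtr g]]
             cov4_mult(4)[OF gtr g]] cov4_mult(5)[OF gtr g]]]]])
       (simp add: dshape_def algebra_simps)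
qed

lemma cov_dshape:
  assumes p: "p \<in> shell J"
  shows "cov5 (Gam p) dshape (\<lambda>f e a b c d. ddshape f e a b c d p) p"
proof -
  note g = cov_gfull[OF p] and vol = cov_vol[OF p] and dgtr = cov_dgtr[OF p] and dvol = cov_dvol[OF p]
  show ?thesis
    unfolding dshape_def[abs_def]
    by (rule cov_eq_rhs(4)[OF cov_diff(4)[OF cov_scale(2)[OF has_grad_const cov_add(4)[OF cov5_mult(1)[OF dvol vol] cov5_mult(2)[OF dvol vol]]]
       cov_scale(2)[OF has_grad_const cov_add(4)[OF cov_diff(4)[OF cov_diff(4)[OF cov5_mult(6)[OF dgtr g] cov5_mult(5)[OF dgtr g]]
             cov5_mult(4)[OF dgtr g]] cov5_mult(3)[OF dgtr g]]]]])
       (simp add: ddshape_def algebra_simps)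
qed

end

text \<open>Here \<open>w1\<close> and \<open>w2\<close> are the first and second proper radial derivatives of the Weyl coefficient.\<close>

locale warped_weyl = warped +
  fixes w1 w2 :: "real \<Rightarrow> real"
  assumes dw: "r \<in> J \<Longrightarrow> (weyl_coeff has_real_derivative w1 r * W r) (at r)"
    and dw1: "r \<in> J \<Longrightarrow> (w1 has_real_derivative w2 r * W r) (at r)"
begin

lemma scalar_grad:
  assumes p: "p \<in> shell J" and f: "(f has_real_derivative f' * W (rad p)) (at (rad p))"
  shows "has_grad (\<lambda>q. f (rad q)) (\<lambda>e. f' * e1 e p) p"
  by (rule has_grad_eq_rhs[OF has_grad_radial[OF _ f]]) (use p in \<open>auto simp: shell_def e1_def\<close>)

text \<open>
  The first and second covariant derivatives of \<open>weyl_coeff\<close> times \<open>shape\<close>, by the Leibniz rule.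
\<close>

definition nabla_weyl_frame :: "4 \<Rightarrow> 4 \<Rightarrow> 4 \<Rightarrow> 4 \<Rightarrow> 4 \<Rightarrow> point \<Rightarrow> real" where
  "nabla_weyl_frame e a b c d p = w1 (rad p) * (e1 e p * shape a b c d p) + (weyl_coeff (rad p) * v (rad p)) * dshape e a b c d p"

lemma nabla_weyl:
  assumes p: "p \<in> shell J"
  shows "nabla4 g (weyl g) e a b c d p = nabla_weyl_frame e a b c d p"
proof -
  have r: "rad p \<in> J" using p by (auto simp: shell_def)
  have "cov4 (Gam p) (weyl g) (\<lambda>e a b c d. nabla_weyl_frame e a b c d p) p"
    by (rule cov4_cong_open[OF cov_eq_rhs(3)[OF cov_scale(1)[OF scalar_grad[OF p dw[OF r]] cov_shape[OF p]]] open_shell[OF J_open] p])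
      (simp_all add: weyl_shape nabla_weyl_frame_def)
  then show ?thesis by (rule nabla4_eq)
qed

definition nabla2_weyl_frame :: "4 \<Rightarrow> 4 \<Rightarrow> 4 \<Rightarrow> 4 \<Rightarrow> 4 \<Rightarrow> 4 \<Rightarrow> point \<Rightarrow> real" where
  "nabla2_weyl_frame f e a b c d p = w2 (rad p) * (e1 f p * (e1 e p * shape a b c d p))
     + w1 (rad p) * ((v (rad p) * gsph f e p - u (rad p) * (e0 f p * e0 e p)) * shape a b c d p
           + v (rad p) * (e1 e p * dshape f a b c d p))
     + (w1 (rad p) * v (rad p) + weyl_coeff (rad p) * v1 (rad p)) * (e1 f p * dshape e a b c d p)
     + (weyl_coeff (rad p) * v (rad p)) * ddshape f e a b c d p"

lemma nabla_nabla_weyl: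
  assumes p: "p \<in> shell J"
  shows "nabla5 g (nabla4 g (weyl g)) f e a b c d p = nabla2_weyl_frame f e a b c d p"
proof -
  have r: "rad p \<in> J" using p by (auto simp: shell_def)
  have s: "has_grad (\<lambda>q. weyl_coeff (rad q) * v (rad q)) (\<lambda>f. (w1 (rad p) * v (rad p) + weyl_coeff (rad p) * v1 (rad p)) * e1 f p) p"
    by (rule has_grad_eq_rhs[OF has_grad_mult[OF scalar_grad[OF p dw[OF r]] scalar_grad[OF p dv[OF r]]]]) (simp add: algebra_simps)
  have "cov5 (Gam p) nabla_weyl_frame (\<lambda>f e a b c d. nabla2_weyl_frame f e a b c d p) p"
    unfolding nabla_weyl_frame_def[abs_def]
    by (rule cov_eq_rhs(4)[OF cov_add(4)[OF cov_scale(2)[OF scalar_grad[OF p dw1[OF r]] cov5_mult14[OF cov_e1[OF p] cov_shape[OF p]]]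
        cov_scale(2)[OF s cov_dshape[OF p]]]]) (simp add: nabla2_weyl_frame_def algebra_simps)
  then have "cov5 (Gam p) (nabla4 g (weyl g)) (\<lambda>f e a b c d. nabla2_weyl_frame f e a b c d p) p"
    by (rule cov5_cong_open[OF _ open_shell[OF J_open] p]) (simp add: nabla_weyl)
  then show ?thesis by (rule nabla5_eq)
qed

section \<open>The Bach equations\<close>

text \<open>
  The Bach tensor is diagonal in the orthonormal frame; these are its \<open>e0\<close>-\<open>e0\<close> and \<open>e1\<close>-\<open>e1\<close>
  components.
\<close>

definition "bach_e0 r = - w2 r - 5 * v r * w1 r - 6 * (v r)\<^sup>2 * weyl_coeff r - 5/2 * v1 r * weyl_coeff r
   + weyl_coeff r * (u1 r + (u r)\<^sup>2 + 1 / (Q r)\<^sup>2 - u r * v r) / 2"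

definition "bach_e1 r = (u r - v r) * w1 r + 5/2 * u r * v r * weyl_coeff r - 2 * (v r)\<^sup>2 * weyl_coeff r
   - weyl_coeff r * (u1 r + (u r)\<^sup>2 + 1 / (Q r)\<^sup>2 - v1 r) / 2"

text \<open>
  The chart places the sphere of radius \<open>r\<close> at distance \<open>exp r\<close> from the \<open>t\<close>-axis, and by symmetry one
  point on it suffices.  At a point on the axis of index \<open>2\<close> the spherical part and the inverse
  metric are diagonal and \<open>e0\<close>, \<open>e1\<close> have one nonzero component each, so the fourfold contraction in the Bach tensor leaves sixteen explicit terms.
\<close>

lemma bach_axis:
  assumes r: "r \<in> J" and p: "p = axis 2 (exp r)"
  shows "p \<in> shell J" "bach g 1 1 p = (U r)\<^sup>2 * bach_e0 r" "bach g 2 2 p = (W r / exp r)\<^sup>2 * bach_e1 r"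
proof -
  have n: "ynorm2 p = (exp r)\<^sup>2" by (simp add: ynorm2_4 p axis_def)
  have pc: "p $ i = (if i = 2 then exp r else 0)" for i by (simp add: p axis_def)
  have rd: "rad p = r" by (simp add: rad_def n real_sqrt_abs)
  show sh: "p \<in> shell J" using r by (simp add: shell_def n rd)
  define A where "A = U r"
  define B where "B = W r / exp r"
  define C where "C = (Q r / exp r)\<^sup>2"
  have nz': "A \<noteq> 0" "B \<noteq> 0" "C \<noteq> 0" using nz[OF r] by (simp_all add: A_def B_def C_def)
  have e0: "e0 i p = (if i = 1 then A else 0)" for i
    by (simp add: e0_def A_def rd dt_form_def)
  have e1: "e1 i p = (if i = 2 then B else 0)" for i
    by (auto simp: e1_def B_def rd dr_form_def n ycoord_def pc power2_eq_square)
  have gsph: "gsph i j p = (if i = j \<and> (i = 3 \<or> i = 4) then C else 0)" for i j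
    by (cases i rule: four_cases; cases j rule: four_cases)
      (auto simp: gsph_def C_def rd sphere_form_def n ycoord_def pc power2_eq_square)
  have gi: "ginv g i j p = (if i = j then (if i = 1 then - 1 / A\<^sup>2 else if i = 2 then 1 / B\<^sup>2 else 1 / C) else 0)" for i j
    unfolding ginv_eq[OF sh] g_inverse_def
    by (cases i rule: four_cases; cases j rule: four_cases)
      (auto simp: A_def B_def C_def rd sphere_proj_def n dt_form_def dr_form_def ycoord_def pc power2_eq_square power_divide)
  have b: "bach g m k p = (\<Sum>i\<in>UNIV. \<Sum>l\<in>UNIV. ginv g i i p * ginv g l l p *
     (nabla2_weyl_frame i l i m l k p + ricci g i l p * (weyl_coeff r * shape i m l k p) / 2))" for m k
  proof -
    have 1: "(\<Sum>b\<in>UNIV. ginv g l b p * f b) = ginv g l l p * f l" for l f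
      by (simp add: gi if_distrib[of "\<lambda>x. x * _"] cong: if_cong)
    have "bach g m k p = (\<Sum>i\<in>UNIV. \<Sum>l\<in>UNIV. \<Sum>a\<in>UNIV. ginv g i a p * (\<Sum>b\<in>UNIV. ginv g l b p *
     (nabla2_weyl_frame a b i m l k p + ricci g a b p * (weyl_coeff r * shape i m l k p) / 2)))"
      unfolding bach_def nabla_nabla_weyl[OF sh] weyl_shape[OF sh] rd by (simp add: sum_distrib_left mult_ac)
    also have "\<dots> = (\<Sum>i\<in>UNIV. \<Sum>l\<in>UNIV. ginv g i i p * (ginv g l l p *
     (nabla2_weyl_frame i l i m l k p + ricci g i l p * (weyl_coeff r * shape i m l k p) / 2)))"
      unfolding 1 ..
    finally show ?thesis by (simp add: mult_ac)
  qed
  note d = nabla2_weyl_frame_def shape_def dshape_def ddshape_def dvol_def ddvol_def dgtr_def ddgtr_def gfull_def vol_def gtr_def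
  show "bach g 1 1 p = (U r)\<^sup>2 * bach_e0 r"
    unfolding b sum_4 ricci_eq[OF sh] Let_def rd d gi bach_e0_def sec_tr_def sec_sph_def sec_r_sph_def sec_t_sph_def A_def[symmetric]
    apply (simp add: e0 e1 gsph)
    using nz' apply (simp add: field_simps power2_eq_square power4_eq_xxxx)
    done
  show "bach g 2 2 p = (W r / exp r)\<^sup>2 * bach_e1 r"
    unfolding b sum_4 ricci_eq[OF sh] Let_def rd d gi bach_e1_def sec_tr_def sec_sph_def sec_r_sph_def sec_t_sph_def B_def[symmetric]
    apply (simp add: e0 e1 gsph)
    using nz' apply (simp add: field_simps power2_eq_square power4_eq_xxxx)
    done
qed

end

text \<open>
  Let \<open>F = (U/r)\<^sup>2\<close> and let a prime be differentiation by \<open>x\<close>, where \<open>dx = (U W/r\<^sup>2) dr\<close>.  The three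
  functions are \<open>a = F'/2\<close>, \<open>G = F''\<close> and \<open>H = F'''/6\<close>, and the last two facts are \<open>F'''' = 0\<close> and
  \<open>2 F' F''' - F''\<^sup>2 + 4 = 0\<close>.  The Weyl coefficient \<open>w\<close> enters through \<open>F'' = 2 - 6 r\<^sup>2 w\<close>, so the first
  of these equations comes from \<open>bach_e0 + bach_e1\<close>, which contains \<open>w''\<close>, and the second one
  from \<open>bach_e1\<close>, which contains only \<open>w'\<close>.
\<close>

lemma bach_flat_ode:
  fixes I :: "real set" and U W :: "real \<Rightarrow> real"
  assumes I: "open I" "I \<subseteq> {0<..}"
    and sm: "smooth_on I U" "smooth_on I W"
    and pos: "\<forall>r\<in>I. U r > 0" "\<forall>r\<in>I. W r > 0"
    and bf: "bach_flat_on (shell I) (static_metric U W)"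
  obtains a G H where
    "\<And>r. r \<in> I \<Longrightarrow> ((\<lambda>r. (U r / r)\<^sup>2) has_real_derivative 2 * a r * (U r * W r / r\<^sup>2)) (at r)"
    "\<And>r. r \<in> I \<Longrightarrow> (a has_real_derivative G r / 2 * (U r * W r / r\<^sup>2)) (at r)"
    "\<And>r. r \<in> I \<Longrightarrow> (G has_real_derivative 6 * H r * (U r * W r / r\<^sup>2)) (at r)"
    "\<And>r. r \<in> I \<Longrightarrow> (H has_real_derivative 0) (at r)"
    "\<And>r. r \<in> I \<Longrightarrow> 24 * a r * H r = (G r)\<^sup>2 - 4"
proof -
  have nz: "U r \<noteq> 0" "W r \<noteq> 0" "r \<noteq> 0" if "r \<in> I" for r using that pos I by fastforce+
  define u where "u r = deriv U r / (U r * W r)" for r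
  define v where "v r = 1 / (r * W r)" for r
  define u1 where "u1 r = deriv u r / W r" for r
  define v1 where "v1 r = deriv v r / W r" for r
  have su: "smooth_on I u" unfolding u_def[abs_def]
    by (intro smooth_on_divide smooth_on_mult smooth_on_deriv sm I) (use nz in auto)
  have sv: "smooth_on I v" unfolding v_def[abs_def]
    by (intro smooth_on_divide smooth_on_mult smooth_on_const smooth_on_ident sm I) (use nz in auto)
  have su1: "smooth_on I u1" unfolding u1_def[abs_def]
    by (intro smooth_on_divide smooth_on_deriv su sm I) (use nz in auto)
  have sv1: "smooth_on I v1" unfolding v1_def[abs_def]
    by (intro smooth_on_divide smooth_on_deriv sv sm I) (use nz in auto)
  have dU: "(U has_real_derivative u r * U r * W r) (at r)" if "r \<in> I" for r
    using smooth_on_deriv(1)[OF I(1) sm(1) that] nz[OF that] by (simp add: u_def)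
  have du: "(u has_real_derivative u1 r * W r) (at r)" if "r \<in> I" for r
    using smooth_on_deriv(1)[OF I(1) su that] nz[OF that] by (simp add: u1_def)
  have dv: "(v has_real_derivative v1 r * W r) (at r)" if "r \<in> I" for r
    using smooth_on_deriv(1)[OF I(1) sv that] nz[OF that] by (simp add: v1_def)
  interpret A: warped I U W "\<lambda>r. r" "deriv W" "deriv (deriv W)" u v u1 v1
  proof
    show "((\<lambda>r. r) has_real_derivative v r * r * W r) (at r)" if "r \<in> I" for r
      using nz[OF that] by (simp add: v_def)
  qed (use I nz dU du dv smooth_on_deriv(1)[OF I(1) sm(2)] smooth_on_deriv(1)[OF I(1) smooth_on_deriv(2)[OF I(1) sm(2)]] in auto)
  define w where "w = A.weyl_coeff"
  define w1 where "w1 r = deriv w r / W r" for r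
  define w2 where "w2 r = deriv w1 r / W r" for r
  have w: "3 * w r = 1 / r\<^sup>2 - u1 r + v1 r - (u r)\<^sup>2 + u r * v r" for r
  proof -
    have "3 * w r = A.sec_tr r + A.sec_sph r - A.sec_r_sph r - A.sec_t_sph r" by (simp add: w_def A.weyl_coeff_def)
    then show ?thesis by (simp add: A.sec_tr_def A.sec_sph_def A.sec_r_sph_def A.sec_t_sph_def)
  qed
  have "w = (\<lambda>r. (1 / r\<^sup>2 - u1 r + v1 r - (u r)\<^sup>2 + u r * v r) / 3)"
    by (rule ext) (simp add: w[symmetric])
  then have sw: "smooth_on I w"
    by (simp only:) (intro smooth_on_divide smooth_on_add smooth_on_diff smooth_on_mult smooth_on_power smooth_on_const smooth_on_ident
        su sv su1 sv1 I; use nz in auto)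
  have sw1: "smooth_on I w1" unfolding w1_def[abs_def]
    by (intro smooth_on_divide smooth_on_deriv sw sm I) (use nz in auto)
  have dw: "(w has_real_derivative w1 r * W r) (at r)" if "r \<in> I" for r
    using smooth_on_deriv(1)[OF I(1) sw that] nz[OF that] by (simp add: w1_def)
  have dw1: "(w1 has_real_derivative w2 r * W r) (at r)" if "r \<in> I" for r
    using smooth_on_deriv(1)[OF I(1) sw1 that] nz[OF that] by (simp add: w2_def)
  interpret B: warped_weyl I U W "\<lambda>r. r" "deriv W" "deriv (deriv W)" u v u1 v1 w1 w2
    by unfold_locales (use dw dw1 in \<open>auto simp: w_def\<close>)
  have g: "A.g = static_metric U W" by (simp add: A.g_def static_metric_def)
  have e0: "B.bach_e0 r = 0" and e1: "B.bach_e1 r = 0" if r: "r \<in> I" for r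
    using B.bach_axis[OF r refl] nz[OF r] bf unfolding bach_flat_on_def g by auto
  have E1: "(u r - v r) * (w1 r + 2 * v r * w r) - w r / r\<^sup>2 + 3/2 * (w r)\<^sup>2 = 0" if r: "r \<in> I" for r
  proof -
    have u1: "u1 r = 1 / r\<^sup>2 + v1 r - (u r)\<^sup>2 + u r * v r - 3 * w r" using w[of r] by simp
    show ?thesis
      using e1[OF r] unfolding B.bach_e1_def w_def[symmetric] u1
      by (simp add: algebra_simps power2_eq_square add_divide_distrib diff_divide_distrib)
  qed
  have E2: "w2 r + (6 * v r - u r) * w1 r + w r * (8 * (v r)\<^sup>2 - 2 * u r * v r + 2 * v1 r) = 0" if r: "r \<in> I" for r
  proof -
    have "B.bach_e0 r + B.bach_e1 r = - (w2 r + (6 * v r - u r) * w1 r + w r * (8 * (v r)\<^sup>2 - 2 * u r * v r + 2 * v1 r))"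
      unfolding B.bach_e0_def B.bach_e1_def w_def[symmetric] by (simp add: field_simps power2_eq_square)
    then show ?thesis using e0[OF r] e1[OF r] by simp
  qed
  define a where "a r = U r * (u r - v r)" for r
  define G where "G r = 2 - 6 * r\<^sup>2 * w r" for r
  define H where "H r = - (r ^ 4 / U r) * (w1 r + 2 * v r * w r)" for r
  have vr: "v r * (r * W r) = 1" if "r \<in> I" for r using nz[OF that] by (simp add: v_def)
  show ?thesis
  proof
    fix r assume r: "r \<in> I"
    note n = nz[OF r]
    have dr: "((\<lambda>r. r) has_real_derivative v r * r * W r) (at r)" using vr[OF r] by (simp add: mult_ac)
    show "((\<lambda>r. (U r / r)\<^sup>2) has_real_derivative 2 * a r * (U r * W r / r\<^sup>2)) (at r)"
      by (rule derivative_eq_intros dU[OF r] dr n refl)+ (use n in \<open>simp add: a_def field_simps power2_eq_square\<close>)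
    have "(a has_real_derivative (U r * (u r * (u r - v r) + u1 r - v1 r)) * W r) (at r)"
      unfolding a_def[abs_def]
      by (rule derivative_eq_intros dU[OF r] du[OF r] dv[OF r] refl)+ (simp add: algebra_simps)
    moreover have "U r * (u r * (u r - v r) + u1 r - v1 r) * r\<^sup>2 = G r / 2 * U r"
    proof -
      have "u r * (u r - v r) + u1 r - v1 r = 1 / r\<^sup>2 - 3 * w r"
        using w[of r] by (simp add: algebra_simps power2_eq_square)
      then have "U r * (u r * (u r - v r) + u1 r - v1 r) * r\<^sup>2 = U r * (1 / r\<^sup>2 - 3 * w r) * r\<^sup>2" by (simp only:)
      also have "\<dots> = G r / 2 * U r" using n by (simp add: G_def field_simps)
      finally show ?thesis .
    qed
    then have "U r * (u r * (u r - v r) + u1 r - v1 r) = G r / 2 * U r / r\<^sup>2"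
      using n by (simp add: eq_divide_eq)
    then have "(U r * (u r * (u r - v r) + u1 r - v1 r)) * W r = G r / 2 * (U r * W r / r\<^sup>2)"
      by (simp only:) simp
    ultimately show "(a has_real_derivative G r / 2 * (U r * W r / r\<^sup>2)) (at r)" by simp
    show "(G has_real_derivative 6 * H r * (U r * W r / r\<^sup>2)) (at r)"
      unfolding G_def[abs_def]
      by (rule derivative_eq_intros dr dw[OF r] refl)+
        (use n in \<open>simp add: H_def field_simps power2_eq_square power4_eq_xxxx\<close>)
    have "(H has_real_derivative - (r ^ 4 / U r) * (w2 r + (6 * v r - u r) * w1 r + w r * (8 * (v r)\<^sup>2 - 2 * u r * v r + 2 * v1 r)) * W r) (at r)"
      unfolding H_def[abs_def]
      by (rule derivative_eq_intros dr dw[OF r] dw1[OF r] dU[OF r] dv[OF r] n refl)+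
        (use n in \<open>simp add: field_simps power2_eq_square power4_eq_xxxx power3_eq_cube\<close>)
    then show "(H has_real_derivative 0) (at r)" using E2[OF r] by simp
    have "24 * a r * H r = - 24 * r ^ 4 * ((u r - v r) * (w1 r + 2 * v r * w r))"
      using n by (simp add: a_def H_def field_simps)
    also have "(u r - v r) * (w1 r + 2 * v r * w r) = w r / r\<^sup>2 - 3/2 * (w r)\<^sup>2" using E1[OF r] by linarith
    also have "- 24 * r ^ 4 * \<dots> = (G r)\<^sup>2 - 4" using n by (simp add: G_def field_simps power2_eq_square power4_eq_xxxx)
    finally show "24 * a r * H r = (G r)\<^sup>2 - 4" .
  qed
qed

lemma zero_derivative_constant:
  fixes f :: "real \<Rightarrow> real"
  assumes "is_interval I" "\<And>r. r \<in> I \<Longrightarrow> (f has_real_derivative 0) (at r)"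
  obtains c where "\<And>r. r \<in> I \<Longrightarrow> f r = c"
proof -
  have "\<exists>c. \<forall>x\<in>I. f x = c"
    using assms by (intro has_field_derivative_zero_constant is_interval_convex) (auto intro: has_field_derivative_at_within)
  then show ?thesis using that by blast
qed

text \<open>
  Here \<open>N\<close> stands for \<open>dx/dr\<close>, so that \<open>y\<close> differs from \<open>x\<close> by a constant.  The constant
  \<open>d = F'''/6\<close> decides.  If it is not zero, \<open>F''\<close> itself is affine in \<open>x\<close>, and \<open>y\<close> is normalized by
  \<open>F'' = 6 d y + 2\<close>.  If it is zero, \<open>F'' = \<plusminus>2\<close> is constant and \<open>\<plusminus>F'/2\<close> serves as \<open>y\<close>.
\<close>

lemma profile_ode_solution:
  fixes F N a G H :: "real \<Rightarrow> real"
  assumes I: "is_interval I" "I \<noteq> {}" and F: "\<And>r. r \<in> I \<Longrightarrow> F r > 0"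
    and dF: "\<And>r. r \<in> I \<Longrightarrow> (F has_real_derivative 2 * a r * N r) (at r)"
    and da: "\<And>r. r \<in> I \<Longrightarrow> (a has_real_derivative G r / 2 * N r) (at r)"
    and dG: "\<And>r. r \<in> I \<Longrightarrow> (G has_real_derivative 6 * H r * N r) (at r)"
    and dH: "\<And>r. r \<in> I \<Longrightarrow> (H has_real_derivative 0) (at r)"
    and cons: "\<And>r. r \<in> I \<Longrightarrow> 24 * a r * H r = (G r)\<^sup>2 - 4"
  obtains (cubic) y d e where "\<And>r. r \<in> I \<Longrightarrow> (y has_real_derivative N r) (at r)"
      "\<And>r. r \<in> I \<Longrightarrow> F r = d * y r ^ 3 + (y r)\<^sup>2 + e" "\<And>r. r \<in> I \<Longrightarrow> a r = 3/2 * d * (y r)\<^sup>2 + y r"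
  | (quadratic) y k where "\<And>r. r \<in> I \<Longrightarrow> (y has_real_derivative N r) (at r)" "k > 0"
      "\<And>r. r \<in> I \<Longrightarrow> F r = k\<^sup>2 - (y r)\<^sup>2" "\<And>r. r \<in> I \<Longrightarrow> a r = - y r"
proof -
  obtain d where d: "\<And>r. r \<in> I \<Longrightarrow> H r = d" using zero_derivative_constant[OF I(1) dH] by blast
  have cub: thesis if y: "\<And>r. r \<in> I \<Longrightarrow> (y has_real_derivative N r) (at r)"
     and a: "\<And>r. r \<in> I \<Longrightarrow> a r = 3/2 * d * (y r)\<^sup>2 + y r" for y
  proof -
    have "((\<lambda>r. F r - (d * y r ^ 3 + (y r)\<^sup>2)) has_real_derivative 0) (at r)" if "r \<in> I" for r
      by (rule derivative_eq_intros dF y that refl)+ (simp add: a[OF that] algebra_simps power2_eq_square)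
    then obtain e where "\<And>r. r \<in> I \<Longrightarrow> F r - (d * y r ^ 3 + (y r)\<^sup>2) = e"
      using zero_derivative_constant[OF I(1)] by blast
    then show ?thesis using cubic[of y d e] y a by (simp add: algebra_simps)
  qed
  show ?thesis
  proof (cases "d = 0")
    case False
    \<comment> \<open>\<open>F'' = 2\<close> holds where \<open>y = 0\<close>, and the second equation then forces \<open>F' = 0\<close> there.\<close>
    show ?thesis
    proof (rule cub[of "\<lambda>r. (G r - 2) / (6 * d)"])
      fix r assume r: "r \<in> I"
      show "((\<lambda>r. (G r - 2) / (6 * d)) has_real_derivative N r) (at r)"
        by (rule derivative_eq_intros dG r refl)+ (use False in \<open>auto simp: d[OF r]\<close>)
      have "a r = ((G r)\<^sup>2 - 4) / (24 * d)"
        using cons[OF r] False by (simp add: d[OF r] eq_divide_eq mult_ac)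
      also have "\<dots> = 3/2 * d * ((G r - 2) / (6 * d))\<^sup>2 + (G r - 2) / (6 * d)"
        using False by (simp add: field_simps power2_eq_square)
      finally show "a r = 3/2 * d * ((G r - 2) / (6 * d))\<^sup>2 + (G r - 2) / (6 * d)" .
    qed
  next
    case True
    have "(G has_real_derivative 0) (at r)" if "r \<in> I" for r using dG[OF that] d[OF that] True by simp
    then obtain c where c: "\<And>r. r \<in> I \<Longrightarrow> G r = c" using zero_derivative_constant[OF I(1)] by blast
    obtain r0 where "r0 \<in> I" using I by blast
    then have "c\<^sup>2 = 2\<^sup>2" using cons[of r0] d[of r0] c[of r0] True by simp
    then consider "c = 2" | "c = -2" using power2_eq_iff by blast
    then show ?thesis
    proof cases
      case 1
      show ?thesis by (rule cub[of a]) (use da c 1 True in auto)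
    next
      case 2
      have y: "((\<lambda>r. - a r) has_real_derivative N r) (at r)" if "r \<in> I" for r
        by (rule derivative_eq_intros da that refl)+ (simp add: c[OF that] 2)
      have "((\<lambda>r. F r + (a r)\<^sup>2) has_real_derivative 0) (at r)" if "r \<in> I" for r
        by (rule derivative_eq_intros da dF that refl)+ (simp add: c[OF that] 2)
      then obtain b where b: "\<And>r. r \<in> I \<Longrightarrow> F r + (a r)\<^sup>2 = b" using zero_derivative_constant[OF I(1)] by blast
      have "b > 0" using b[OF \<open>r0 \<in> I\<close>] F[OF \<open>r0 \<in> I\<close>] zero_le_power2[of "a r0"] by linarith
      then show ?thesis using quadratic[of "\<lambda>r. - a r" "sqrt b"] y b by (simp add: algebra_simps)
    qed
  qed
qed

section \<open>Radial maps\<close>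

definition ypart :: "point \<Rightarrow> point" where
  "ypart p = p - (p $ 1) *\<^sub>R axis 1 1"

definition yinner :: "point \<Rightarrow> point \<Rightarrow> real" where
  "yinner p q = p $ 2 * q $ 2 + p $ 3 * q $ 3 + p $ 4 * q $ 4"

text \<open>
  The map \<open>(t, r, \<omega>) \<mapsto> (k t, R r, \<omega>)\<close>.  In the chart the point \<open>y = exp r \<cdot> \<omega>\<close> goes to
  \<open>exp (R r) \<cdot> \<omega>\<close>, which is \<open>y\<close> times \<open>exp (R r - r)\<close>.
\<close>

definition radial_map :: "real \<Rightarrow> (real \<Rightarrow> real) \<Rightarrow> point \<Rightarrow> point" where
  "radial_map k R p = (k * p $ 1) *\<^sub>R axis 1 1 + exp (R (rad p) - rad p) *\<^sub>R ypart p"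

lemma ynorm2_yinner: "ynorm2 p = yinner p p"
  by (simp add: ynorm2_4 yinner_def power2_eq_square)

lemma ynorm2_exp_rad: "ynorm2 p \<noteq> 0 \<Longrightarrow> ynorm2 p = (exp (rad p))\<^sup>2"
  using ynorm2_nonneg[of p] by (simp add: rad_def)

lemma rad_eqI: "ynorm2 p = (exp s)\<^sup>2 \<Longrightarrow> rad p = s"
  by (simp add: rad_def)

lemma ypart_nth: "ypart p $ i = (if i = 1 then 0 else p $ i)"
  by (simp add: ypart_def axis_def)

lemma radial_map_nth: "radial_map k R p $ i = (if i = 1 then k * p $ 1 else exp (R (rad p) - rad p) * p $ i)"
  by (simp add: radial_map_def ypart_nth axis_def)

lemma ynorm2_radial_map:
  assumes "ynorm2 p \<noteq> 0" shows "ynorm2 (radial_map k R p) = (exp (R (rad p)))\<^sup>2"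
proof -
  have "ynorm2 (radial_map k R p) = (exp (R (rad p) - rad p))\<^sup>2 * ynorm2 p"
    by (simp add: ynorm2_4 radial_map_nth power_mult_distrib distrib_left)
  also have "\<dots> = (exp (R (rad p) - rad p) * exp (rad p))\<^sup>2"
    by (simp add: ynorm2_exp_rad[OF assms] power_mult_distrib)
  finally show ?thesis by (simp add: mult_exp_exp)
qed

lemma rad_radial_map: "ynorm2 p \<noteq> 0 \<Longrightarrow> rad (radial_map k R p) = R (rad p)"
  by (rule rad_eqI) (rule ynorm2_radial_map)

lemma radial_map_radial_map:
  assumes "ynorm2 p \<noteq> 0"
  shows "radial_map l G (radial_map k R p) $ i = (if i = 1 then l * k * p $ 1 else exp (G (R (rad p)) - rad p) * p $ i)"
  by (simp add: radial_map_nth rad_radial_map[OF assms] mult_exp_exp mult.assoc[symmetric])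

lemma radial_map_inverse:
  assumes "ynorm2 p \<noteq> 0" "l * k = 1" "G (R (rad p)) = rad p"
  shows "radial_map l G (radial_map k R p) = p"
  using assms by (simp add: vec_eq_iff radial_map_radial_map)

lemma radial_map_shell:
  assumes "p \<in> shell J" shows "radial_map k R p \<in> shell (R ` J)"
proof -
  have "ynorm2 p \<noteq> 0" "rad p \<in> J" using assms by (auto simp: shell_def)
  then show ?thesis by (auto simp: shell_def rad_radial_map ynorm2_radial_map)
qed

lemma radial_map_image:
  assumes "inj_on R J" "k \<noteq> 0"
  shows "inj_on (radial_map k R) (shell J)" "radial_map k R ` shell J = shell (R ` J)"
    "\<And>q. q \<in> shell (R ` J) \<Longrightarrow> inv_into (shell J) (radial_map k R) q = radial_map (1/k) (inv_into J R) q"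
proof -
  let ?G = "inv_into J R"
  have 1: "radial_map (1/k) ?G (radial_map k R p) = p" if "p \<in> shell J" for p
    using that assms by (intro radial_map_inverse) (auto simp: shell_def)
  have 2: "radial_map k R (radial_map (1/k) ?G q) = q" if "q \<in> shell (R ` J)" for q
    using that assms by (intro radial_map_inverse) (auto simp: shell_def f_inv_into_f)
  have 3: "radial_map (1/k) ?G q \<in> shell J" if "q \<in> shell (R ` J)" for q
    using radial_map_shell[OF that, of "1/k" ?G] assms by simp
  show inj: "inj_on (radial_map k R) (shell J)" by (rule inj_on_inverseI[where g = "radial_map (1/k) ?G"]) (rule 1)
  show im: "radial_map k R ` shell J = shell (R ` J)"
  proof
    show "shell (R ` J) \<subseteq> radial_map k R ` shell J"
    proof
      fix q assume "q \<in> shell (R ` J)"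
      then show "q \<in> radial_map k R ` shell J" using 2[of q] 3[of q] by (intro image_eqI[of _ _ "radial_map (1/k) ?G q"]) simp_all
    qed
  qed (auto intro: radial_map_shell)
  show "inv_into (shell J) (radial_map k R) q = radial_map (1/k) ?G q" if "q \<in> shell (R ` J)" for q
    by (rule inv_into_f_eq[OF inj 3[OF that] 2[OF that]])
qed

lemma smooth_on_nth: "smooth_on S (\<lambda>p::point. p $ i)"
  unfolding smooth_on_def
proof
  fix k
  have "\<And>x::point. ((\<lambda>p. p $ i) has_derivative (\<lambda>h. h $ i)) (at x)"
    by (intro bounded_linear.has_derivative[OF bounded_linear_vec_nth] derivative_intros)
  then have "Ck_on k UNIV (\<lambda>p::point. p $ i)"
    by (cases k) (auto intro!: Ck_on_SucI Ck_on_const continuous_intros simp del: Ck_on.simps(2))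
  then show "Ck_on k S (\<lambda>p::point. p $ i)" by (rule Ck_on_subset) simp
qed

lemma smooth_on_ypart: "smooth_on S ypart"
proof -
  have "bounded_linear ypart"
    unfolding ypart_def[abs_def]
    by (intro bounded_linear_sub bounded_linear_ident bounded_linear_scaleR_left bounded_linear_vec_nth
        bounded_linear_compose[OF bounded_linear_scaleR_left])
  from smooth_on_linear[OF open_UNIV this smooth_on_ident] show ?thesis
    by (rule smooth_on_subset) simp
qed

lemma smooth_on_ynorm2: "smooth_on S ynorm2"
proof -
  have "smooth_on UNIV (\<lambda>p::point. (p$2)\<^sup>2 + (p$3)\<^sup>2 + (p$4)\<^sup>2)"
    by (intro smooth_on_add smooth_on_power smooth_on_nth open_UNIV)
  then show ?thesis unfolding ynorm2_4[abs_def] by (rule smooth_on_subset) simp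
qed

lemma smooth_on_rad:
  assumes "open J" shows "smooth_on (shell J) rad"
proof -
  note o = open_shell[OF assms]
  have p: "ynorm2 p > 0" if "p \<in> shell J" for p
    using that ynorm2_nonneg[of p] by (auto simp: shell_def)
  have "smooth_on (shell J) (\<lambda>p. sqrt (ynorm2 p))"
    by (rule smooth_on_compose_real[OF smooth_on_sqrt o _ smooth_on_ynorm2]) (auto dest: p)
  then show ?thesis unfolding rad_def[abs_def]
    by (rule smooth_on_compose_real[OF smooth_on_ln o, rotated]) (auto dest: p)
qed

lemma smooth_on_radial:
  fixes f :: "real \<Rightarrow> real"
  assumes "open J" "smooth_on J f" shows "smooth_on (shell J) (\<lambda>p. f (rad p))"
  by (rule smooth_on_compose_real[OF assms(2) open_shell[OF assms(1)] assms(1) smooth_on_rad[OF assms(1)]])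
    (auto simp: shell_def)

lemma smooth_on_radial_map:
  assumes "open J" "smooth_on J R" shows "smooth_on (shell J) (radial_map k R)"
proof -
  note o = open_shell[OF assms(1)]
  have 1: "smooth_on (shell J) (\<lambda>p. exp (R (rad p) - rad p))"
    by (rule smooth_on_compose_real[OF smooth_on_exp o open_UNIV])
      (intro smooth_on_diff o smooth_on_radial smooth_on_rad assms, simp)
  show ?thesis unfolding radial_map_def[abs_def]
    by (intro smooth_on_add smooth_on_scaleR o 1 smooth_on_ypart smooth_on_const smooth_on_mult smooth_on_nth)
qed

lemma rad_has_derivative:
  assumes "ynorm2 p \<noteq> 0"
  shows "(rad has_derivative (\<lambda>h. yinner p h / ynorm2 p)) (at p)"
proof -
  have "(\<Sum>k\<in>UNIV. dr_form k p * h $ k) = yinner p h / ynorm2 p" for h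
    by (simp add: sum_4 dr_form_def ycoord_def yinner_def add_divide_distrib)
  then show ?thesis using has_grad_rad[OF assms] by (simp add: has_grad_def)
qed

lemma radial_map_has_derivative:
  assumes n: "ynorm2 p \<noteq> 0" and R: "(R has_real_derivative R') (at (rad p))"
  shows "(radial_map k R has_derivative (\<lambda>h. (k * h $ 1) *\<^sub>R axis 1 1 +
     exp (R (rad p) - rad p) *\<^sub>R (((R' - 1) * (yinner p h / ynorm2 p)) *\<^sub>R ypart p + ypart h))) (at p)"
proof -
  have nth: "((\<lambda>p. p $ 1) has_derivative (\<lambda>h. h $ 1)) (at p)" for p :: point
    by (intro bounded_linear.has_derivative[OF bounded_linear_vec_nth] derivative_intros)
  have y: "(ypart has_derivative ypart) (at p)"
    unfolding ypart_def[abs_def] by (intro derivative_intros nth)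
  have s: "((\<lambda>s. exp (R s - s)) has_real_derivative exp (R (rad p) - rad p) * (R' - 1)) (at (rad p))"
    by (rule derivative_eq_intros R refl)+
  have e: "((\<lambda>p. exp (R (rad p) - rad p)) has_derivative
      (\<lambda>h. exp (R (rad p) - rad p) * (R' - 1) * (yinner p h / ynorm2 p))) (at p)"
    using diff_chain_at[OF rad_has_derivative[OF n] s[unfolded has_field_derivative_def]] by (simp add: o_def)
  show ?thesis
    unfolding radial_map_def[abs_def]
    by (rule derivative_eq_intros nth y e refl | simp add: fun_eq_iff scaleR_add_right)+
qed

lemma sym_metric_form:
  assumes n: "ynorm2 p \<noteq> 0"
  shows "x \<bullet> (sym_metric A B C p *v y) = - A (rad p) * x $ 1 * y $ 1
    + B (rad p) * (yinner p x / ynorm2 p) * (yinner p y / ynorm2 p)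
    + C (rad p) * (yinner x y / ynorm2 p - (yinner p x / ynorm2 p) * (yinner p y / ynorm2 p))"
proof -
  have e: "sphere_form i j p = (if i = j \<and> i \<noteq> 1 then 1 / ynorm2 p else 0) - dr_form i p * dr_form j p" for i j
    by (auto simp: sphere_form_def dr_form_def diff_divide_distrib)
  have d: "yinner p h / ynorm2 p = dr_form 2 p * h$2 + dr_form 3 p * h$3 + dr_form 4 p * h$4" for h
    by (simp add: dr_form_def ycoord_def yinner_def add_divide_distrib)
  have d1: "dr_form 1 p = 0" by (simp add: dr_form_def ycoord_def)
  show ?thesis
    unfolding d by (simp add: inner_vec_def matrix_vector_mult_def sum_4 sym_metric_def e dt_form_def d1 yinner_def add_divide_distrib algebra_simps)
qed

text \<open>
  A radial map pulls \<open>dt\<close> back to \<open>k dt\<close> and \<open>dr\<close> to \<open>R' dr\<close>, and preserves the round metric of the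
  sphere; so conformality amounts to three equations between coefficients.
\<close>

lemma radial_conformal_map:
  assumes J: "open J" and R: "smooth_on J R" "inj_on R J" and D: "\<And>r. r \<in> J \<Longrightarrow> (R has_real_derivative R' r) (at r)"
    and R': "\<And>r. r \<in> J \<Longrightarrow> R' r \<noteq> 0" and k: "k \<noteq> 0"
    and om: "smooth_on J \<omega>" "\<And>r. r \<in> J \<Longrightarrow> \<omega> r > 0"
    and A: "\<And>r. r \<in> J \<Longrightarrow> A' (R r) * k\<^sup>2 = (\<omega> r)\<^sup>2 * A r"
    and B: "\<And>r. r \<in> J \<Longrightarrow> B' (R r) * (R' r)\<^sup>2 = (\<omega> r)\<^sup>2 * B r"
    and C: "\<And>r. r \<in> J \<Longrightarrow> C' (R r) = (\<omega> r)\<^sup>2 * C r"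
    and T: "shell (R ` J) \<subseteq> T"
  shows "conformal_map (shell J) (sym_metric A B C) T (sym_metric A' B' C') (radial_map k R)"
  unfolding conformal_map_def
proof (intro conjI)
  note im = radial_map_image[OF R(2) k]
  have dR: "deriv R r \<noteq> 0" if "r \<in> J" for r using DERIV_imp_deriv[OF D[OF that]] R'[OF that] by simp
  have inv: "open (R ` J)" "smooth_on (R ` J) (inv_into J R)"
    by (rule smooth_on_inverse_function[OF J R]; rule dR; assumption)+
  show "radial_map k R ` shell J \<subseteq> T" using im(2) T by simp
  show o: "open (radial_map k R ` shell J)" unfolding im(2) by (rule open_shell[OF inv(1)])
  show "inj_on (radial_map k R) (shell J)" by (rule im(1))
  show "smooth_on (shell J) (radial_map k R)" by (rule smooth_on_radial_map[OF J R(1)])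
  show "smooth_on (radial_map k R ` shell J) (inv_into (shell J) (radial_map k R))"
    unfolding im(2)
    by (rule smooth_on_cong[OF open_shell[OF inv(1)] smooth_on_radial_map[OF inv, of "1/k"]]) (rule im(3)[symmetric])
  show "\<exists>\<Omega>. smooth_on (shell J) \<Omega> \<and> (\<forall>p\<in>shell J. \<Omega> p > 0) \<and>
        (\<forall>p\<in>shell J. \<forall>u v.
           frechet_derivative (radial_map k R) (at p) u \<bullet>
              (sym_metric A' B' C' (radial_map k R p) *v frechet_derivative (radial_map k R) (at p) v)
           = (\<Omega> p)\<^sup>2 * (u \<bullet> (sym_metric A B C p *v v)))"
  proof (intro exI conjI ballI allI)
    show "smooth_on (shell J) (\<lambda>p. \<omega> (rad p))" by (rule smooth_on_radial[OF J om(1)])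
    show "\<omega> (rad p) > 0" if "p \<in> shell J" for p using that om(2) by (auto simp: shell_def)
    fix p x y assume p: "p \<in> shell J"
    then have n: "ynorm2 p \<noteq> 0" and r: "rad p \<in> J" by (auto simp: shell_def)
    define c where "c = exp (R (rad p) - rad p)"
    have c: "c \<noteq> 0" by (simp add: c_def)
    define h where "h x = yinner p x / ynorm2 p" for x
    define L where "L x = (k * x $ 1) *\<^sub>R axis 1 1 + c *\<^sub>R (((R' (rad p) - 1) * h x) *\<^sub>R ypart p + ypart x)" for x
    let ?q = "radial_map k R p"
    have L: "frechet_derivative (radial_map k R) (at p) = L"
      using frechet_derivative_at[OF radial_map_has_derivative[OF n D[OF r], of k]]
      by (simp add: L_def[abs_def] c_def h_def)
    have nq: "ynorm2 ?q = c\<^sup>2 * ynorm2 p"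
      by (simp add: ynorm2_4 radial_map_nth power_mult_distrib distrib_left c_def)
    have nq0: "ynorm2 ?q \<noteq> 0" using nq n c by simp
    have rq: "rad ?q = R (rad p)" by (rule rad_radial_map[OF n])
    have L1: "L x $ 1 = k * x $ 1" for x by (simp add: L_def ypart_nth)
    have Li: "L x $ i = c * ((R' (rad p) - 1) * h x * p $ i + x $ i)" if "i \<noteq> 1" for x i
      using that by (simp add: L_def ypart_nth axis_def)
    have hp: "yinner p x = h x * ynorm2 p" for x using n by (simp add: h_def)
    have bil: "yinner (L x) (L y) = c\<^sup>2 * (((R' (rad p) - 1) * h x) * ((R' (rad p) - 1) * h y) * yinner p p
       + (R' (rad p) - 1) * h x * yinner p y + (R' (rad p) - 1) * h y * yinner p x + yinner x y)" for x y
      by (simp add: yinner_def Li power2_eq_square algebra_simps)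
    have qL: "yinner ?q (L x) = c\<^sup>2 * ((R' (rad p) - 1) * h x * yinner p p + yinner p x)" for x
      by (simp add: yinner_def Li radial_map_nth c_def[symmetric] power2_eq_square algebra_simps)
    have 1: "yinner ?q (L x) / ynorm2 ?q = R' (rad p) * h x" for x
      unfolding qL nq hp ynorm2_yinner[symmetric] using n c by (simp add: field_simps)
    have 2: "yinner (L x) (L y) / ynorm2 ?q = (R' (rad p))\<^sup>2 * h x * h y + (yinner x y / ynorm2 p - h x * h y)" for x y
      unfolding bil nq hp ynorm2_yinner[symmetric] using n c by (simp add: field_simps power2_eq_square)
    have "L x \<bullet> (sym_metric A' B' C' ?q *v L y) = - (A' (R (rad p)) * k\<^sup>2) * (x $ 1 * y $ 1)
       + (B' (R (rad p)) * (R' (rad p))\<^sup>2) * h x * h y + C' (R (rad p)) * (yinner x y / ynorm2 p - h x * h y)"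
      unfolding sym_metric_form[OF nq0] rq 1 2 L1 by (simp add: algebra_simps power2_eq_square)
    also have "\<dots> = (\<omega> (rad p))\<^sup>2 * (x \<bullet> (sym_metric A B C p *v y))"
      unfolding sym_metric_form[OF n] A[OF r] B[OF r] C[OF r] h_def[symmetric] by (simp add: algebra_simps)
    finally show "frechet_derivative (radial_map k R) (at p) x \<bullet>
              (sym_metric A' B' C' ?q *v frechet_derivative (radial_map k R) (at p) y)
           = (\<omega> (rad p))\<^sup>2 * (x \<bullet> (sym_metric A B C p *v y))" unfolding L .
  qed
qed

section \<open>The two model spaces\<close>

lemma (in warped) einstein_onI:
  assumes "\<And>r. r \<in> J \<Longrightarrow> sec_tr r + 2 * sec_t_sph r = k" "\<And>r. r \<in> J \<Longrightarrow> sec_tr r + 2 * sec_r_sph r = k"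
    "\<And>r. r \<in> J \<Longrightarrow> sec_sph r + sec_r_sph r + sec_t_sph r = k"
  shows "einstein_on (shell J) g"
  unfolding einstein_on_def
proof (intro exI ballI allI)
  fix p a b assume p: "p \<in> shell J"
  then have r: "rad p \<in> J" by (simp add: shell_def)
  show "ricci g a b p = k * g p $ a $ b"
    unfolding ricci_eq[OF p] g_frame Let_def assms[OF r] by (simp add: algebra_simps)
qed

text \<open>
  The factor \<open>\<omega>\<close> may be negative: a conformal factor has to be positive, and the square root of
  \<open>\<omega>\<^sup>2\<close> is smooth and positive wherever \<open>\<omega> \<noteq> 0\<close>.
\<close>

lemma conformally_einstein_onI:
  assumes J: "open J" and om: "smooth_on J \<omega>" "\<And>r. r \<in> J \<Longrightarrow> \<omega> r \<noteq> 0"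
    and E: "einstein_on (shell J) (sym_metric (\<lambda>r. (\<omega> r)\<^sup>2 * A r) (\<lambda>r. (\<omega> r)\<^sup>2 * B r) (\<lambda>r. (\<omega> r)\<^sup>2 * C r))"
  shows "conformally_einstein_on (shell J) (sym_metric A B C)"
  unfolding conformally_einstein_on_def
proof (intro exI conjI ballI)
  have 1: "smooth_on J (\<lambda>r. sqrt ((\<omega> r)\<^sup>2))"
    by (rule smooth_on_compose_real[OF smooth_on_sqrt J _ smooth_on_power[OF J om(1)]]) (auto simp: om(2))
  show "smooth_on (shell J) (\<lambda>p. sqrt ((\<omega> (rad p))\<^sup>2))" by (rule smooth_on_radial[OF J 1])
  show "sqrt ((\<omega> (rad p))\<^sup>2) > 0" if "p \<in> shell J" for p using that om(2) by (auto simp: shell_def)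
  have "(\<lambda>p. (sqrt ((\<omega> (rad p))\<^sup>2))\<^sup>2 *\<^sub>R sym_metric A B C p)
     = sym_metric (\<lambda>r. (\<omega> r)\<^sup>2 * A r) (\<lambda>r. (\<omega> r)\<^sup>2 * B r) (\<lambda>r. (\<omega> r)\<^sup>2 * C r)"
    by (auto simp: fun_eq_iff vec_eq_iff sym_metric_def algebra_simps)
  then show "einstein_on (shell J) (\<lambda>p. (sqrt ((\<omega> (rad p))\<^sup>2))\<^sup>2 *\<^sub>R sym_metric A B C p)"
    using E by simp
qed

text \<open>
  Here \<open>a\<close> is half the derivative of \<open>F = (U/r)\<^sup>2\<close> by \<open>x\<close>; as \<open>U > 0\<close>, it determines the derivative of \<open>U\<close>.
\<close>

lemma lapse_derivative:
  fixes U :: "real \<Rightarrow> real"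
  assumes r: "r > 0" and U: "U r > 0" and d: "U differentiable at r"
    and F: "((\<lambda>r. (U r / r)\<^sup>2) has_real_derivative 2 * a * (U r * W / r\<^sup>2)) (at r)"
  shows "(U has_real_derivative a * W + U r / r) (at r)"
proof -
  obtain D where D: "(U has_real_derivative D) (at r)" using d by (auto simp: real_differentiable_def)
  have "((\<lambda>r. (U r / r)\<^sup>2) has_real_derivative 2 * (U r / r) * ((D * r - U r) / r\<^sup>2)) (at r)"
    using r by (auto intro!: derivative_eq_intros D simp: field_simps power2_eq_square)
  from DERIV_unique[OF this F] have "(2 * U r / r\<^sup>2) * ((D * r - U r) / r) = (2 * U r / r\<^sup>2) * (a * W)"
    by (simp add: power2_eq_square mult_ac)
  moreover have "2 * U r / r\<^sup>2 \<noteq> 0" using r U by simp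
  ultimately have "(D * r - U r) / r = a * W" using mult_left_cancel by blast
  then have "D = a * W + U r / r" using r by (simp add: field_simps)
  with D show ?thesis by simp
qed

lemma inj_on_positive_derivative:
  fixes y N :: "real \<Rightarrow> real"
  assumes "is_interval I" "\<And>r. r \<in> I \<Longrightarrow> (y has_real_derivative N r) (at r)" "\<And>r. r \<in> I \<Longrightarrow> N r > 0"
  shows "inj_on y I"
proof (rule linorder_inj_onI')
  fix s t assume st: "s \<in> I" "t \<in> I" "s < t"
  have "y s < y t"
  proof (rule DERIV_pos_imp_increasing[OF st(3)])
    fix x assume "s \<le> x" "x \<le> t"
    then have "x \<in> I" using st assms(1) by (meson mem_is_interval_1_I)
    then show "\<exists>d. (y has_real_derivative d) (at x) \<and> d > 0" using assms(2,3) by blast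
  qed
  then show "y s \<noteq> y t" by simp
qed

text \<open>
  The part of the solution that both cases share, on an open set \<open>J\<close> of radii from which the zero of
  \<open>y\<close> may have been removed.
\<close>

locale radial_profile =
  fixes J :: "real set" and U W y a :: "real \<Rightarrow> real"
  assumes J: "open J" "J \<subseteq> {0<..}" and sm: "smooth_on J U" "smooth_on J W"
    and pos: "\<And>r. r \<in> J \<Longrightarrow> U r > 0" "\<And>r. r \<in> J \<Longrightarrow> W r > 0"
    and F: "\<And>r. r \<in> J \<Longrightarrow> ((\<lambda>r. (U r / r)\<^sup>2) has_real_derivative 2 * a r * (U r * W r / r\<^sup>2)) (at r)"
    and dy: "\<And>r. r \<in> J \<Longrightarrow> (y has_real_derivative U r * W r / r\<^sup>2) (at r)"
begin

lemma nz: "r \<in> J \<Longrightarrow> U r \<noteq> 0" "r \<in> J \<Longrightarrow> W r \<noteq> 0" "r \<in> J \<Longrightarrow> r \<noteq> 0"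
  using pos J by force+

lemma dU:
  assumes "r \<in> J" shows "(U has_real_derivative a r * W r + U r / r) (at r)"
proof (rule lapse_derivative)
  show "U differentiable at r"
    using smooth_on_deriv(1)[OF J(1) sm(1) assms] by (auto simp: real_differentiable_def)
qed (use assms J pos F in auto)

lemma dW: "r \<in> J \<Longrightarrow> (W has_real_derivative deriv W r) (at r)"
  by (rule smooth_on_deriv(1)[OF J(1) sm(2)])

lemma smooth_y: "smooth_on J y"
  by (rule smooth_on_real_deriv[OF J(1) dy])
    (auto intro!: smooth_on_divide smooth_on_mult smooth_on_power smooth_on_ident sm J simp: nz)

text \<open>
  The rescaled metric \<open>(r y)\<^sup>-\<^sup>2 g\<close> is \<open>y\<^sup>-\<^sup>2 (-F dt\<^sup>2 + dy\<^sup>2/F + g\<^sub>S)\<close>.  With \<open>s = U/r\<close>, hence \<open>F = s\<^sup>2\<close>, its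
  proper radial derivative satisfies \<open>D y = y s\<close> and \<open>D s = y a\<close>.  From this all sectional
  curvatures become polynomials in \<open>y\<close>, and \<open>F = d y\<^sup>3 + y\<^sup>2 + e\<close> makes the three Ricci eigenvalues
  equal to \<open>-3 e\<close>.
\<close>

lemma cubic_conformally_einstein:
  assumes y0: "\<And>r. r \<in> J \<Longrightarrow> y r \<noteq> 0"
    and F: "\<And>r. r \<in> J \<Longrightarrow> (U r / r)\<^sup>2 = d * y r ^ 3 + (y r)\<^sup>2 + e"
    and a: "\<And>r. r \<in> J \<Longrightarrow> a r = 3/2 * d * (y r)\<^sup>2 + y r"
  shows "conformally_einstein_on (shell J) (static_metric U W)"
proof -
  define \<omega> where "\<omega> r = 1 / (r * y r)" for r
  have om0: "\<omega> r \<noteq> 0" if "r \<in> J" for r using nz[OF that] y0[OF that] by (simp add: \<omega>_def)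
  have som: "smooth_on J \<omega>" unfolding \<omega>_def[abs_def]
    by (intro smooth_on_divide smooth_on_mult smooth_on_const smooth_on_ident smooth_y J) (use nz y0 in auto)
  have dom: "(\<omega> has_real_derivative - (1 / r + U r * W r / (r\<^sup>2 * y r)) * \<omega> r) (at r)" if r: "r \<in> J" for r
    unfolding \<omega>_def[abs_def] using nz[OF r] y0[OF r]
    by (auto intro!: derivative_eq_intros dy[OF r] simp: field_simps power2_eq_square)
  \<comment> \<open>With \<open>s = U/r\<close>, the logarithmic derivatives of \<open>s/y\<close> and \<open>1/y\<close> are \<open>y a/s - s\<close> and \<open>-s\<close>.\<close>
  define u where "u r = y r * a r * r / U r - U r / r" for r
  define v where "v r = - U r / r" for r
  define u1 where "u1 r = (y r)\<^sup>2 * (3 * d * y r + 1) - (y r * a r * r / U r)\<^sup>2" for r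
  define v1 where "v1 r = - a r * y r" for r
  have da: "(a has_real_derivative (3 * d * y r + 1) * (U r * W r / r\<^sup>2)) (at r)" if r: "r \<in> J" for r
  proof -
    have "((\<lambda>r. 3/2 * d * (y r)\<^sup>2 + y r) has_real_derivative (3 * d * y r + 1) * (U r * W r / r\<^sup>2)) (at r)"
      by (rule derivative_eq_intros dy[OF r] refl)+ (simp add: algebra_simps add_divide_distrib)
    then show ?thesis using has_field_derivative_transform_within_open[OF _ J(1) r] a by (metis (no_types, lifting))
  qed
  have sW: "smooth_on J (\<lambda>r. \<omega> r * W r)" by (intro smooth_on_mult J som sm)
  interpret E: warped J "\<lambda>r. \<omega> r * U r" "\<lambda>r. \<omega> r * W r" "\<lambda>r. \<omega> r * r" "deriv (\<lambda>r. \<omega> r * W r)"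
     "deriv (deriv (\<lambda>r. \<omega> r * W r))" u v u1 v1
  proof
    fix r assume r: "r \<in> J"
    note n = nz[OF r] y0[OF r]
    show "((\<lambda>r. \<omega> r * U r) has_real_derivative u r * (\<omega> r * U r) * (\<omega> r * W r)) (at r)"
      by (rule derivative_eq_intros dom[OF r] dU[OF r] refl)+
        (use n in \<open>simp add: u_def \<omega>_def field_simps power2_eq_square\<close>)
    show "((\<lambda>r. \<omega> r * r) has_real_derivative v r * (\<omega> r * r) * (\<omega> r * W r)) (at r)"
      by (rule derivative_eq_intros dom[OF r] refl)+
        (use n in \<open>simp add: v_def \<omega>_def field_simps power2_eq_square\<close>)
    show "(u has_real_derivative u1 r * (\<omega> r * W r)) (at r)"
      unfolding u_def[abs_def]
      by (rule derivative_eq_intros dy[OF r] da[OF r] dU[OF r] n refl)+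
        (use n in \<open>simp add: u1_def \<omega>_def field_simps power2_eq_square\<close>)
    show "(v has_real_derivative v1 r * (\<omega> r * W r)) (at r)"
      unfolding v_def[abs_def]
      by (rule derivative_eq_intros dU[OF r] n refl)+
        (use n in \<open>simp add: v1_def \<omega>_def field_simps power2_eq_square\<close>)
  qed (use J om0 nz smooth_on_deriv(1)[OF J(1) sW] smooth_on_deriv(1)[OF J(1) smooth_on_deriv(2)[OF J(1) sW]] in auto)
  have E: "einstein_on (shell J) E.g"
  proof (rule E.einstein_onI[where k = "- 3 * e"])
    fix r assume r: "r \<in> J"
    note n = nz[OF r] y0[OF r]
    define s where "s = U r / r"
    have s: "s \<noteq> 0" "s\<^sup>2 = d * y r ^ 3 + (y r)\<^sup>2 + e" using n F[OF r] by (auto simp: s_def)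
    have u: "u r = y r * a r / s - s" "v r = - s" "u1 r = (y r)\<^sup>2 * (3 * d * y r + 1) - (y r * a r / s)\<^sup>2"
      by (simp_all add: u_def v_def u1_def s_def)
    have K: "E.sec_tr r = - (y r)\<^sup>2 * (3 * d * y r + 1) + 2 * y r * a r - s\<^sup>2"
      unfolding E.sec_tr_def u using s(1) by (simp add: field_simps power2_eq_square)
    have q: "E.sec_t_sph r = y r * a r - s\<^sup>2" unfolding E.sec_t_sph_def u using s(1) by (simp add: field_simps power2_eq_square)
    have p: "E.sec_r_sph r = y r * a r - s\<^sup>2" unfolding E.sec_r_sph_def u v1_def by (simp add: mult.commute)
    have L: "E.sec_sph r = (y r)\<^sup>2 - s\<^sup>2" unfolding E.sec_sph_def u using n by (simp add: \<omega>_def power_divide)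
    show "E.sec_tr r + 2 * E.sec_t_sph r = - 3 * e" "E.sec_tr r + 2 * E.sec_r_sph r = - 3 * e" "E.sec_sph r + E.sec_r_sph r + E.sec_t_sph r = - 3 * e"
      unfolding K q p L s(2) a[OF r] by (simp_all add: algebra_simps power2_eq_square power3_eq_cube)
  qed
  show ?thesis
    unfolding static_metric_def
    by (rule conformally_einstein_onI[OF J(1) som om0]) (use E in \<open>auto simp: E.g_def power_mult_distrib\<close>)
qed

text \<open>
  Here \<open>r\<^sup>-\<^sup>2 g\<close> is a product with the unit sphere, and \<open>F'' = -2\<close> gives its Lorentzian factor
  curvature \<open>1\<close> as well.
\<close>

lemma quadratic_conformally_einstein:
  assumes a: "\<And>r. r \<in> J \<Longrightarrow> a r = - y r"
  shows "conformally_einstein_on (shell J) (static_metric U W)"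
proof -
  define \<omega> where "\<omega> r = 1 / r" for r :: real
  have om0: "\<omega> r \<noteq> 0" if "r \<in> J" for r using nz[OF that] by (simp add: \<omega>_def)
  have som: "smooth_on J \<omega>" unfolding \<omega>_def[abs_def]
    by (intro smooth_on_divide smooth_on_const smooth_on_ident J) (use nz in auto)
  have dom: "(\<omega> has_real_derivative - (1 / r) * \<omega> r) (at r)" if r: "r \<in> J" for r
    unfolding \<omega>_def[abs_def] using nz[OF r]
    by (auto intro!: derivative_eq_intros simp: field_simps power2_eq_square)
  define u where "u r = - y r * r / U r" for r
  define u1 where "u1 r = - 1 - (y r * r / U r)\<^sup>2" for r
  have sW: "smooth_on J (\<lambda>r. \<omega> r * W r)" by (intro smooth_on_mult J som sm)
  interpret E: warped J "\<lambda>r. \<omega> r * U r" "\<lambda>r. \<omega> r * W r" "\<lambda>r. \<omega> r * r" "deriv (\<lambda>r. \<omega> r * W r)"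
     "deriv (deriv (\<lambda>r. \<omega> r * W r))" u "\<lambda>r. 0" u1 "\<lambda>r. 0"
  proof
    fix r assume r: "r \<in> J"
    note n = nz[OF r]
    show "((\<lambda>r. \<omega> r * U r) has_real_derivative u r * (\<omega> r * U r) * (\<omega> r * W r)) (at r)"
      by (rule derivative_eq_intros dom[OF r] dU[OF r] refl)+
        (use n in \<open>simp add: u_def \<omega>_def a[OF r] field_simps power2_eq_square\<close>)
    show "((\<lambda>r. \<omega> r * r) has_real_derivative 0 * (\<omega> r * r) * (\<omega> r * W r)) (at r)"
      by (rule derivative_eq_intros dom[OF r] refl)+
        (use n in \<open>simp add: \<omega>_def field_simps power2_eq_square\<close>)
    show "(u has_real_derivative u1 r * (\<omega> r * W r)) (at r)"
      unfolding u_def[abs_def]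
      by (rule derivative_eq_intros dy[OF r] dU[OF r] n refl)+
        (use n in \<open>simp add: u1_def \<omega>_def a[OF r] field_simps power2_eq_square\<close>)
  qed (use J om0 nz smooth_on_deriv(1)[OF J(1) sW] smooth_on_deriv(1)[OF J(1) smooth_on_deriv(2)[OF J(1) sW]] in auto)
  have E: "einstein_on (shell J) E.g"
  proof (rule E.einstein_onI[where k = 1])
    fix r assume r: "r \<in> J"
    show "E.sec_tr r + 2 * E.sec_t_sph r = 1" "E.sec_tr r + 2 * E.sec_r_sph r = 1" "E.sec_sph r + E.sec_r_sph r + E.sec_t_sph r = 1"
      unfolding E.sec_tr_def E.sec_t_sph_def E.sec_r_sph_def E.sec_sph_def
      using nz[OF r] by (simp_all add: u_def u1_def \<omega>_def power2_eq_square)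
  qed
  show ?thesis
    unfolding static_metric_def
    by (rule conformally_einstein_onI[OF J(1) som om0]) (use E in \<open>auto simp: E.g_def power_mult_distrib\<close>)
qed

text \<open>
  The new radius is \<open>1/y\<close>, since the spheres of \<open>(r y)\<^sup>-\<^sup>2 g\<close> have this radius up to sign.  The lapse
  there is \<open>F/y\<^sup>2\<close>, which is positive, so the image avoids the horizons.
\<close>

lemma cubic_conformal_map:
  assumes inj: "inj_on y J" and y0: "\<And>r. r \<in> J \<Longrightarrow> y r \<noteq> 0"
    and F: "\<And>r. r \<in> J \<Longrightarrow> (U r / r)\<^sup>2 = d * y r ^ 3 + (y r)\<^sup>2 + e"
  shows "conformal_map (shell J) (static_metric U W) (sds_space (- d) (- 3 * e)) (sds_metric (- d) (- 3 * e))
     (radial_map 1 (\<lambda>r. 1 / y r))"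
proof -
  have f: "sds_lapse (- d) (- 3 * e) (1 / y r) = (U r / (r * y r))\<^sup>2" if r: "r \<in> J" for r
  proof -
    have "(U r / (r * y r))\<^sup>2 = (d * y r ^ 3 + (y r)\<^sup>2 + e) / (y r)\<^sup>2"
      unfolding F[OF r, symmetric] by (simp add: power_divide power_mult_distrib)
    then show ?thesis using y0[OF r] by (simp add: sds_lapse_def field_simps power2_eq_square power3_eq_cube)
  qed
  show ?thesis
    unfolding static_metric_def sds_metric_def
  proof (rule radial_conformal_map[where \<omega> = "\<lambda>r. sqrt ((1 / (r * y r))\<^sup>2)" and R' = "\<lambda>r. - (U r * W r / r\<^sup>2) / (y r)\<^sup>2"])
    show "smooth_on J (\<lambda>r. 1 / y r)" by (intro smooth_on_divide smooth_on_const smooth_y J y0)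
    show "inj_on (\<lambda>r. 1 / y r) J" using inj y0 by (auto simp: inj_on_def)
    have "smooth_on J (\<lambda>r. (1 / (r * y r))\<^sup>2)"
      by (intro smooth_on_power smooth_on_divide smooth_on_const smooth_on_mult smooth_on_ident smooth_y J) (use nz y0 in auto)
    then show "smooth_on J (\<lambda>r. sqrt ((1 / (r * y r))\<^sup>2))"
      by (rule smooth_on_compose_real[OF smooth_on_sqrt J(1), rotated]) (use nz y0 in auto)
    show "shell ((\<lambda>r. 1 / y r) ` J) \<subseteq> sds_space (- d) (- 3 * e)"
      using f nz y0 by (auto simp: sds_space_def shell_def)
    fix r assume r: "r \<in> J"
    note n = nz[OF r] y0[OF r]
    have om: "(sqrt ((1 / (r * y r))\<^sup>2))\<^sup>2 = (1 / (r * y r))\<^sup>2" by (rule real_sqrt_pow2) simp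
    show "((\<lambda>r. 1 / y r) has_real_derivative - (U r * W r / r\<^sup>2) / (y r)\<^sup>2) (at r)"
      using n by (auto intro!: derivative_eq_intros dy[OF r] simp: power2_eq_square)
    show "- (U r * W r / r\<^sup>2) / (y r)\<^sup>2 \<noteq> 0" "sqrt ((1 / (r * y r))\<^sup>2) > 0" using n by auto
    show "sds_lapse (- d) (- 3 * e) (1 / y r) * 1\<^sup>2 = (sqrt ((1 / (r * y r))\<^sup>2))\<^sup>2 * (U r)\<^sup>2"
      unfolding f[OF r] om by (simp add: power_divide)
    show "1 / sds_lapse (- d) (- 3 * e) (1 / y r) * (- (U r * W r / r\<^sup>2) / (y r)\<^sup>2)\<^sup>2 = (sqrt ((1 / (r * y r))\<^sup>2))\<^sup>2 * (W r)\<^sup>2"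
      unfolding f[OF r] om using n by (simp add: field_simps power2_eq_square)
    show "(1 / y r)\<^sup>2 = (sqrt ((1 / (r * y r))\<^sup>2))\<^sup>2 * r\<^sup>2" unfolding om using n by (simp add: power_divide power_mult_distrib)
  qed (use J in auto)
qed

text \<open>
  From \<open>F = k\<^sup>2 - y\<^sup>2 > 0\<close> follows \<open>\<bar>y\<bar> < k\<close>, so \<open>arcsin (y/k)\<close> is defined and smooth; its cosine is \<open>U/(k r)\<close>.
\<close>

lemma quadratic_conformal_map:
  assumes inj: "inj_on y J" and k: "k > 0"
    and F: "\<And>r. r \<in> J \<Longrightarrow> (U r / r)\<^sup>2 = k\<^sup>2 - (y r)\<^sup>2"
  shows "conformal_map (shell J) (static_metric U W) cos_space cos_metric (radial_map k (\<lambda>r. arcsin (y r / k)))"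
proof -
  have b: "y r / k \<in> {-1<..<1}" if r: "r \<in> J" for r
  proof -
    have "(U r / r)\<^sup>2 > 0" using nz[OF r] by simp
    then have "(y r)\<^sup>2 < k\<^sup>2" using F[OF r] by simp
    then have "\<bar>y r\<bar> < k" using k power2_less_imp_less[of "\<bar>y r\<bar>" k] by simp
    then show ?thesis using k by (auto simp: field_simps abs_less_iff)
  qed
  have c: "1 - (y r / k)\<^sup>2 = (U r / (r * k))\<^sup>2" if r: "r \<in> J" for r
  proof -
    have "(U r / (r * k))\<^sup>2 = (U r / r)\<^sup>2 / k\<^sup>2" by (simp add: power_divide power_mult_distrib)
    also have "\<dots> = 1 - (y r / k)\<^sup>2" unfolding F[OF r] using k by (simp add: diff_divide_distrib power_divide)
    finally show ?thesis by simp
  qed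
  have c': "sqrt (1 - (y r / k)\<^sup>2) = U r / (r * k)" if r: "r \<in> J" for r
    unfolding c[OF r] using pos(1)[OF r] J(2) r k by (auto simp: real_sqrt_abs)
  show ?thesis
    unfolding static_metric_def cos_metric_def
  proof (rule radial_conformal_map[where \<omega> = "\<lambda>r. 1 / r" and R' = "\<lambda>r. W r / r"])
    show "smooth_on J (\<lambda>r. arcsin (y r / k))"
      by (rule smooth_on_compose_real[OF smooth_on_arcsin J(1)])
        (use b k in \<open>auto intro!: smooth_on_divide smooth_y smooth_on_const J\<close>)
    show "inj_on (\<lambda>r. arcsin (y r / k)) J"
    proof (rule inj_onI)
      fix r s assume rs: "r \<in> J" "s \<in> J" "arcsin (y r / k) = arcsin (y s / k)"
      then have "y r / k = y s / k" using b[OF rs(1)] b[OF rs(2)] by (metis greaterThanLessThan_iff less_imp_le sin_arcsin)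
      then show "r = s" using inj rs k by (auto simp: inj_on_def)
    qed
    show "smooth_on J (\<lambda>r. 1 / r)" by (intro smooth_on_divide smooth_on_const smooth_on_ident J) (use nz in auto)
    have "arcsin (y r / k) \<in> {- pi / 2<..<pi / 2}" if r: "r \<in> J" for r
      using arcsin_lt_bounded[of "y r / k"] b[OF r] by auto
    then show "shell ((\<lambda>r. arcsin (y r / k)) ` J) \<subseteq> cos_space"
      by (auto simp: cos_space_def shell_def)
    fix r assume r: "r \<in> J"
    note n = nz[OF r]
    have "((\<lambda>r. arcsin (y r / k)) has_real_derivative inverse (sqrt (1 - (y r / k)\<^sup>2)) * (U r * W r / r\<^sup>2 / k)) (at r)"
      using b[OF r] k by (auto intro!: DERIV_chain2[OF DERIV_arcsin] derivative_eq_intros dy[OF r])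
    moreover have "inverse (sqrt (1 - (y r / k)\<^sup>2)) * (U r * W r / r\<^sup>2 / k) = W r / r"
      unfolding c'[OF r] using n k by (simp add: field_simps power2_eq_square)
    ultimately show "((\<lambda>r. arcsin (y r / k)) has_real_derivative W r / r) (at r)" by simp
    show "W r / r \<noteq> 0" "1 / r > 0" using n J r by auto
    have "(cos (arcsin (y r / k)))\<^sup>2 = (U r / (r * k))\<^sup>2"
      unfolding cos_squared_eq c[OF r, symmetric] using b[OF r] by simp
    then show "(cos (arcsin (y r / k)))\<^sup>2 * k\<^sup>2 = (1 / r)\<^sup>2 * (U r)\<^sup>2"
      using k by (simp add: power_divide power_mult_distrib)
    show "1 * (W r / r)\<^sup>2 = (1 / r)\<^sup>2 * (W r)\<^sup>2" by (simp add: power_divide)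
    show "1 = (1 / r)\<^sup>2 * r\<^sup>2" using n by (simp add: power_divide)
  qed (use J k inj in auto)
qed

end

section \<open>Classification of static spherically symmetric Bach-flat metrics\<close>

theorem theorem4p1:
  fixes I :: "real set" and U W :: "real \<Rightarrow> real"
  assumes "open I" and "is_interval I" and "I \<noteq> {}" and "I \<subseteq> {0<..}"
    and "smooth_on I U" and "smooth_on I W"
    and "\<forall>r\<in>I. U r > 0" and "\<forall>r\<in>I. W r > 0"
    and "bach_flat_on (shell I) (static_metric U W)"
  shows "almost_conformally_einstein I (static_metric U W) \<and>
         ((\<exists>m \<Lambda>. almost_conformal I (static_metric U W) (sds_space m \<Lambda>) (sds_metric m \<Lambda>)) \<or>
          almost_conformal I (static_metric U W) cos_space cos_metric)"
proof -
  let ?N = "\<lambda>r. U r * W r / r\<^sup>2"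
  have pos: "U r > 0" "W r > 0" "r > 0" if "r \<in> I" for r using assms(4,7,8) that by auto
  have N: "?N r > 0" if "r \<in> I" for r using pos[OF that] by simp
  obtain a G H where
    F: "\<And>r. r \<in> I \<Longrightarrow> ((\<lambda>r. (U r / r)\<^sup>2) has_real_derivative 2 * a r * ?N r) (at r)" and
    a: "\<And>r. r \<in> I \<Longrightarrow> (a has_real_derivative G r / 2 * ?N r) (at r)" and
    G: "\<And>r. r \<in> I \<Longrightarrow> (G has_real_derivative 6 * H r * ?N r) (at r)" and
    H: "\<And>r. r \<in> I \<Longrightarrow> (H has_real_derivative 0) (at r)" and
    c: "\<And>r. r \<in> I \<Longrightarrow> 24 * a r * H r = (G r)\<^sup>2 - 4"
    using bach_flat_ode[OF assms(1,4-9)] by blast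
  have Fpos: "(U r / r)\<^sup>2 > 0" if "r \<in> I" for r using pos[OF that] by simp
  have profile: "radial_profile J U W y a"
    if "open J" "J \<subseteq> I" "\<And>r. r \<in> I \<Longrightarrow> (y has_real_derivative ?N r) (at r)" for J y
    by unfold_locales (use that assms pos F in \<open>auto intro: smooth_on_subset\<close>)
  show ?thesis
  proof (rule profile_ode_solution[OF assms(2,3) Fpos F a G H c])
    fix y d e
    assume y: "\<And>r. r \<in> I \<Longrightarrow> (y has_real_derivative ?N r) (at r)"
      and Fy: "\<And>r. r \<in> I \<Longrightarrow> (U r / r)\<^sup>2 = d * y r ^ 3 + (y r)\<^sup>2 + e"
      and ay: "\<And>r. r \<in> I \<Longrightarrow> a r = 3/2 * d * (y r)\<^sup>2 + y r"
    have inj: "inj_on y I" by (rule inj_on_positive_derivative[OF assms(2) y N])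
    \<comment> \<open>The exceptional radius, if there is one.\<close>
    define E where "E = {r\<in>I. y r = 0}"
    have EE: "E = {} \<or> (\<exists>s\<in>I. E = {s})"
    proof (cases "E = {}")
      case False
      then obtain s where "s \<in> E" by blast
      then have "E = {s}" using inj unfolding E_def inj_on_def by auto
      with \<open>s \<in> E\<close> show ?thesis by (auto simp: E_def)
    qed simp
    then have fin: "finite E" by auto
    have ce: "conformally_einstein_on (shell K) (static_metric U W)" if K: "open K" "K \<subseteq> I - E" for K
    proof -
      interpret radial_profile K U W y a by (rule profile) (use K y in auto)
      show ?thesis by (rule cubic_conformally_einstein[of d e]) (use K Fy ay in \<open>auto simp: E_def\<close>)
    qed
    have "almost_conformally_einstein I (static_metric U W)"
      using EE
    proof
      assume "E = {}"
      then show ?thesis using ce[of I] assms(1) by (simp add: almost_conformally_einstein_def)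
    next
      assume "\<exists>s\<in>I. E = {s}"
      then obtain s where s: "s \<in> I" "E = {s}" by blast
      have "conformally_einstein_on (shell (I \<inter> {..<s})) (static_metric U W)"
        "conformally_einstein_on (shell (I \<inter> {s<..})) (static_metric U W)"
        by (rule ce; use assms(1) s in auto)+
      then show ?thesis unfolding almost_conformally_einstein_def using s(1) by blast
    qed
    moreover have "conformal_map (shell (I - E)) (static_metric U W) (sds_space (- d) (- 3 * e)) (sds_metric (- d) (- 3 * e))
     (radial_map 1 (\<lambda>r. 1 / y r))"
    proof -
      have o: "open (I - E)" using assms(1) fin by (simp add: finite_imp_closed open_Diff)
      interpret radial_profile "I - E" U W y a by (rule profile) (use o y in auto)
      show ?thesis by (rule cubic_conformal_map) (use Fy inj in \<open>auto simp: E_def intro: inj_on_subset\<close>)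
    qed
    then have "\<exists>m \<Lambda>. almost_conformal I (static_metric U W) (sds_space m \<Lambda>) (sds_metric m \<Lambda>)"
      unfolding almost_conformal_def using fin by blast
    ultimately show ?thesis by blast
  next
    fix y k
    assume y: "\<And>r. r \<in> I \<Longrightarrow> (y has_real_derivative ?N r) (at r)" and k: "k > 0"
      and Fy: "\<And>r. r \<in> I \<Longrightarrow> (U r / r)\<^sup>2 = k\<^sup>2 - (y r)\<^sup>2"
      and ay: "\<And>r. r \<in> I \<Longrightarrow> a r = - y r"
    interpret radial_profile I U W y a by (rule profile[OF assms(1) subset_refl y])
    have inj: "inj_on y I" by (rule inj_on_positive_derivative[OF assms(2) y N])
    have "almost_conformally_einstein I (static_metric U W)"
      unfolding almost_conformally_einstein_def using quadratic_conformally_einstein[OF ay] by blast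
    moreover have "almost_conformal I (static_metric U W) cos_space cos_metric"
      unfolding almost_conformal_def using quadratic_conformal_map[OF inj k Fy] by (intro exI[of _ "{}"]) auto
    ultimately show ?thesis by blast
  qed
qed

end
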